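(* For an approach function $h$ and a function $u$ harmonic in the unit disc $\mathbb D$, consider the condition $$(\ast)_h\qquad \lim_{z\in \Omega^h(\varphi),\,z\to e^{i\varphi}}u(z)=0 \quad\text{for every } \varphi\in [0,2\pi].$$ (a) If $h$ is an approach function with $h(t)=o(t^3)$ as $t\to 0$, then there exists a function $u\not=0$ harmonic in $\mathbb D$ and satisfying $(\ast)_h$ such that $$M_r(|u|)=O((1-r)^{-2}),\qquad r\to 1-.$$ (b) If $1<\gamma\le 3$, $h(t)=t^\gamma$ and $\varepsilon>0$, then there exists a function $u\not=0$ harmonic in $\mathbb D$ and satisfying $(\ast)_h$ such that $$\log^+M_r(|u|)\le\varepsilon (1-r)^{-1}, \qquad r \in (0,1).$$ (c) If $h(t)=ct$ with $c>0$, and $\varepsilon>0$, then there exists a function $u\not=0$ harmonic in $\mathbb D$ and satisfying $(\ast)_h$ such that $$\log^+M_r(|u|)\le\varepsilon(1-r)^{-\pi/(2\arctan (1/c))}, \qquad r \in (0,1).$$ (d) If $0<\gamma<1$ and $h(t)=t^\gamma$, then for some $k=k(\gamma)$ there exists a function $u\not=0$ harmonic in $\mathbb D$ and satisfying $(\ast)_h$ such that $$\log^+\log^+M_r(|u|)\le k(1-r)^{\gamma-1},\qquad r \in (0,1).$$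
   Context: $\mathbb D=\{z\in\mathbb C:|z|<1\}$. Harmonic functions are real-valued; $u\neq 0$ means $u$ is not identically zero. For a real-valued continuous function $v$ on $\mathbb D$ and $0<r<1$, $M_r(v)=\max_{0\le\theta\le 2\pi}v(re^{i\theta})$; so $M_r(|u|)=\max_\theta |u(re^{i\theta})|$. $\log^+ s=\max(\log s,0)$ for $s>0$ and $\log^+ 0=0$. Approach regions: for a non-decreasing continuous function $h:[0,1]\to[0,\infty)$ with $h(0)=0$ (an approach function), put $\Delta^h=\{x+iy:|x|\le h(y),\,0<y<1\}\subset\mathbb C_+=\{x+iy\in\mathbb C:y>0\}$. For $\varphi\in[0,2\pi]$ let $f_\varphi(z)=e^{i\varphi}\frac{i-z}{i+z}$, which maps $\mathbb C_+$ conformally onto $\mathbb D$ and sends $0$ to $e^{i\varphi}$. Put $\Omega^h(\varphi)=f_\varphi(\Delta^h)$. *)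

theory Defs
  imports "HOL-Analysis.Analysis" "HOL-Library.Landau_Symbols"
begin

text \<open>
  A real-valued function on an open subset of the plane is harmonic if it is of class $C^2$ and
  its Laplacian vanishes. The witnesses \<open>ux\<close>, \<open>uy\<close>, \<open>uxx\<close>, and so on are the first and second
  partial derivatives with respect to the real coordinates \<open>x = Re z\<close> and \<open>y = Im z\<close>.
\<close>

definition harmonic_on :: "complex set \<Rightarrow> (complex \<Rightarrow> real) \<Rightarrow> bool" where
  "harmonic_on S u \<longleftrightarrow> open S \<and>
     (\<exists>ux uy uxx uxy uyx uyy :: complex \<Rightarrow> real.
        (\<forall>z\<in>S. (u has_derivative (\<lambda>w. ux z * Re w + uy z * Im w)) (at z)) \<and>
        (\<forall>z\<in>S. (ux has_derivative (\<lambda>w. uxx z * Re w + uxy z * Im w)) (at z)) \<and>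
        (\<forall>z\<in>S. (uy has_derivative (\<lambda>w. uyx z * Re w + uyy z * Im w)) (at z)) \<and>
        continuous_on S uxx \<and> continuous_on S uxy \<and>
        continuous_on S uyx \<and> continuous_on S uyy \<and>
        (\<forall>z\<in>S. uxx z + uyy z = 0))"

abbreviation unit_disc :: "complex set" where
  "unit_disc \<equiv> ball 0 1"

text \<open>
  The supremum is a maximum whenever \<open>v\<close> is continuous on the disc and \<open>0 < r < 1\<close>;
  see \<open>circle_max_attained\<close> below.
\<close>

definition circle_max :: "real \<Rightarrow> (complex \<Rightarrow> real) \<Rightarrow> real" where
  "circle_max r v = (SUP \<theta>\<in>{0..2*pi}. v (of_real r * exp (\<i> * of_real \<theta>)))"

definition log_plus :: "real \<Rightarrow> real" where
  "log_plus s = (if s > 0 then max (ln s) 0 else 0)"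

text \<open>
  Only the values of \<open>h\<close> on \<open>[0,1]\<close> matter; nonnegativity there follows from monotonicity
  and \<open>h 0 = 0\<close>.
\<close>

definition approach_function :: "(real \<Rightarrow> real) \<Rightarrow> bool" where
  "approach_function h \<longleftrightarrow> continuous_on {0..1} h \<and> mono_on {0..1} h \<and> h 0 = 0"

definition approach_Delta :: "(real \<Rightarrow> real) \<Rightarrow> complex set" where
  "approach_Delta h = {Complex x y | x y. \<bar>x\<bar> \<le> h y \<and> 0 < y \<and> y < 1}"

definition disc_map :: "real \<Rightarrow> complex \<Rightarrow> complex" where
  "disc_map \<phi> z = exp (\<i> * of_real \<phi>) * ((\<i> - z) / (\<i> + z))"

definition approach_Omega :: "(real \<Rightarrow> real) \<Rightarrow> real \<Rightarrow> complex set" where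
  "approach_Omega h \<phi> = disc_map \<phi> ` approach_Delta h"

definition vanishing_approach_limits :: "(real \<Rightarrow> real) \<Rightarrow> (complex \<Rightarrow> real) \<Rightarrow> bool" where
  "vanishing_approach_limits h u \<longleftrightarrow>
     (\<forall>\<phi>\<in>{0..2*pi}. (u \<longlongrightarrow> 0) (at (exp (\<i> * of_real \<phi>)) within approach_Omega h \<phi>))"

lemma circle_max_attained:
  assumes "continuous_on unit_disc v" "0 < r" "r < 1"
  shows "\<exists>\<theta>\<in>{0..2*pi}. circle_max r v = v (of_real r * exp (\<i> * of_real \<theta>)) \<and>
           (\<forall>\<theta>'\<in>{0..2*pi}. v (of_real r * exp (\<i> * of_real \<theta>')) \<le> circle_max r v)"
proof -
  let ?f = "\<lambda>\<theta>. v (of_real r * exp (\<i> * of_real \<theta>))"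
  have "continuous_on {0..2*pi} ?f"
    by (rule continuous_on_compose2[OF assms(1)])
       (use assms(2,3) in \<open>auto intro!: continuous_intros simp: norm_mult\<close>)
  then obtain t where t: "t \<in> {0..2*pi}" "\<forall>s\<in>{0..2*pi}. ?f s \<le> ?f t"
    using continuous_attains_sup[of "{0..2*pi}" ?f] by auto
  have "circle_max r v = ?f t"
    unfolding circle_max_def by (rule cSup_eq_maximum) (use t in auto)
  then show ?thesis using t by auto
qed

lemma approach_function_powr:
  assumes "0 < \<gamma>"
  shows "approach_function (\<lambda>t. t powr \<gamma>)"
proof -
  have "continuous_on {0..1} (\<lambda>t. t powr \<gamma>)"
    by (rule continuous_on_powr') (use assms in \<open>auto intro: continuous_intros\<close>)
  then show ?thesis
    unfolding approach_function_def
    using assms by (auto intro!: mono_onI powr_mono2)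
qed

lemma approach_function_linear:
  assumes "0 < c"
  shows "approach_function (\<lambda>t. c * t)"
  unfolding approach_function_def
  using assms by (auto intro!: continuous_intros mono_onI)

end

theory Submission
  imports Defs "HOL-Complex_Analysis.Complex_Analysis" "HOL-Probability.Sinc_Integral"
begin

text \<open>
  The map $\zeta = i(1+z)/(1-z)$ sends the disc to the upper half-plane and the point 1 to infinity; in
  terms of the coordinate $w$ with $z = f_0(w)$ it is $\zeta = -1/w$. Below, $w = x + iy$ and $\zeta = \xi + i\eta$. If $F$ is an entire function that is
  real on the real axis, then $u(z) = \mathrm{Im}\,F(\zeta)$ is harmonic in the disc and tends to 0 at every
  boundary point except 1. So the approach condition reduces to one at the point 1: that
  $\mathrm{Im}\,F(-1/w) \to 0$ as $w \to 0$ in $\Delta^h$. Growth of $F$ turns into growth of $u$ because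
  $|\zeta| \le 2/(1-r)$. Each part of the theorem is thus a question about one entire function.

  For a region thinner than cubic, $F(\zeta) = \zeta^2$ suffices (\<open>cubic_tangency\<close>). For the wider regions $F$ has
  to be small on the whole image of the region under $w \mapsto -1/w$, and large only in a domain around
  the positive axis. Such functions are given by the Cauchy type integral
  $$F(\zeta) = \int_{\mathrm{Re}\,z = a} W(z)\,\frac{T(z)}{T(z) - \zeta}\,|dz|, \qquad
    W(z) = \Bigl(\frac{\sinh \varepsilon z}{z}\Bigr)^6,$$
  where $T$ maps the right half-plane into the domain where $F$ is allowed to be large. By Cauchy's
  theorem (\<open>vline_integral_shift\<close>) the line can be moved as long as no pole is crossed. Moving it
  to the right shows that $F$ is entire, with $|F(\zeta)| \le A e^{6\varepsilon a}$ once $|T| \ge 2|\zeta|$ on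
  $\mathrm{Re}\,z = a$ (\<open>transform_growth\<close>). If $\zeta$ keeps a distance from the image of $T$, the line can be moved to
  the imaginary axis, where $W$ is integrable with room to spare, and $F(\zeta) = O(1/|\zeta|)$ follows
  (\<open>transform_decay\<close>). Finally $F(0) = \int W$ is positive because $W(iy) = (\sin(\varepsilon y)/y)^6$, so $F$ is not
  constant (\<open>transform_0_nonzero\<close>).

  It remains to choose $T$, up to a translation of the variable. For $h(t) = t^\gamma$ with $\gamma > 1$ it is
  $Z + Z^\beta$ with $\beta < 1$, and $F$ has small exponential type. For $h(t) = ct$ it is $1 + Z^\kappa$, a sector,
  and the order of $F$ is at most $1/\kappa$. For $h(t) = t^\gamma$ with $\gamma < 1$ it is $\kappa(\log Z)^p$ with $p = \gamma/(1-\gamma)$: the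
  image of $T$ is a curvilinear strip, and the growth is doubly exponential.
\<close>

section \<open>Integrals over vertical lines\<close>

definition vline_integral :: "real \<Rightarrow> (complex \<Rightarrow> complex) \<Rightarrow> complex" where
  "vline_integral a g = (LINT y|lborel. g (Complex a y))"

abbreviation half_plane :: "complex set" where
  "half_plane \<equiv> {z. 0 \<le> Re z}"

lemma integrable_inverse_1_plus_sq: "integrable lborel (\<lambda>y::real. K / (1 + y\<^sup>2))"
proof -
  have "integrable lborel (\<lambda>y::real. inverse (1 + y\<^sup>2))"
    using integrable_inverse_1_plus_square by (simp add: set_integrable_def)
  then have "integrable lborel (\<lambda>y::real. K * inverse (1 + y\<^sup>2))"
    by (rule integrable_mult_right)
  then show ?thesis by (simp add: divide_inverse)
qed

lemma vline_decay:
  fixes z :: complex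
  assumes "0 \<le> K"
  shows "K / (1 + norm z)\<^sup>2 \<le> K / (1 + (Im z)\<^sup>2)"
proof -
  have "(Im z)\<^sup>2 \<le> (norm z)\<^sup>2" using abs_Im_le_cmod[of z] by (simp add: abs_le_square_iff[symmetric])
  then have "1 + (Im z)\<^sup>2 \<le> (1 + norm z)\<^sup>2"
    using norm_ge_zero[of z] by (simp add: power2_sum add_increasing2)
  then show ?thesis using assms
    by (intro divide_left_mono) (auto intro!: mult_pos_pos add_pos_nonneg zero_less_power)
qed

lemma vline_measurable:
  fixes g :: "complex \<Rightarrow> complex"
  assumes "continuous_on {z. Re z = a} g"
  shows "(\<lambda>y. g (Complex a y)) \<in> borel_measurable lborel"
proof -
  have "continuous_on UNIV (\<lambda>y. g (Complex a y))"
    by (rule continuous_on_compose2[OF assms(1)])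
       (auto simp: Complex_eq intro!: continuous_intros)
  then show ?thesis by (simp add: borel_measurable_continuous_onI)
qed

lemma vline_integrable:
  fixes g :: "complex \<Rightarrow> complex"
  assumes "continuous_on {z. Re z = a} g"
    and bound: "\<And>y. norm (g (Complex a y)) \<le> K / (1 + norm (Complex a y))\<^sup>2"
  shows "integrable lborel (\<lambda>y. g (Complex a y))"
proof (rule Bochner_Integration.integrable_bound[OF integrable_inverse_1_plus_sq[of "\<bar>K\<bar>"]])
  show "AE y in lborel. norm (g (Complex a y)) \<le> norm (\<bar>K\<bar> / (1 + y\<^sup>2))"
  proof (rule AE_I2)
    fix y
    have "norm (g (Complex a y)) \<le> \<bar>K\<bar> / (1 + norm (Complex a y))\<^sup>2"
      by (rule order_trans[OF bound]) (simp add: divide_right_mono)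
    also have "\<dots> \<le> \<bar>K\<bar> / (1 + y\<^sup>2)" using vline_decay[of "\<bar>K\<bar>" "Complex a y"] by simp
    finally show "norm (g (Complex a y)) \<le> norm (\<bar>K\<bar> / (1 + y\<^sup>2))" by simp
  qed
qed (rule vline_measurable[OF assms(1)])

lemma vline_integral_norm_le:
  assumes "continuous_on {z. Re z = a} g" "0 \<le> K"
    and bound: "\<And>y. norm (g (Complex a y)) \<le> K / (1 + norm (Complex a y))\<^sup>2"
  shows "norm (vline_integral a g) \<le> K * (LINT y|lborel. 1 / (1 + y\<^sup>2))"
proof -
  have "norm (vline_integral a g) \<le> (LINT y|lborel. K / (1 + y\<^sup>2))"
    unfolding vline_integral_def
  proof (rule Bochner_Integration.integral_norm_bound_integral)
    fix y
    show "norm (g (Complex a y)) \<le> K / (1 + y\<^sup>2)"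
      using bound[of y] vline_decay[OF assms(2), of "Complex a y"] by simp
  qed (use vline_integrable[OF assms(1) bound] integrable_inverse_1_plus_sq in auto)
  also have "\<dots> = K * (LINT y|lborel. 1 / (1 + y\<^sup>2))"
    by (subst integral_mult_right_zero[symmetric]) simp
  finally show ?thesis .
qed

lemma vline_integral_truncate:
  assumes "continuous_on {z. Re z = a} g"
    and bound: "\<And>y. norm (g (Complex a y)) \<le> K / (1 + norm (Complex a y))\<^sup>2"
  shows "((\<lambda>N. integral {-N..N} (\<lambda>y. g (Complex a y))) \<longlongrightarrow> vline_integral a g) at_top"
proof -
  let ?f = "\<lambda>y. g (Complex a y)"
  note int = vline_integrable[OF assms]
  have "((\<lambda>N. LINT y|lborel. indicator {-N..N} y *\<^sub>R ?f y) \<longlongrightarrow> vline_integral a g) at_top"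
    unfolding vline_integral_def
  proof (rule integral_dominated_convergence_at_top[where w = "\<lambda>y. norm (?f y)"])
    show "AE y in lborel. ((\<lambda>N. indicator {-N..N} y *\<^sub>R ?f y) \<longlongrightarrow> ?f y) at_top"
    proof (rule AE_I2)
      fix y :: real
      have "\<forall>\<^sub>F N in at_top. indicator {-N..N} y *\<^sub>R ?f y = ?f y"
        using eventually_ge_at_top[of "\<bar>y\<bar>"] by eventually_elim (auto simp: indicator_def)
      then show "((\<lambda>N. indicator {-N..N} y *\<^sub>R ?f y) \<longlongrightarrow> ?f y) at_top"
        by (rule tendsto_eventually)
    qed
  next
    show "\<forall>\<^sub>F N in at_top. AE y in lborel. norm (indicator {-N..N} y *\<^sub>R ?f y) \<le> norm (?f y)"
      by (intro always_eventually allI AE_I2) (auto simp: indicator_def)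
  qed (use int in \<open>auto intro!: borel_measurable_scaleR borel_measurable_indicator simp: borel_measurable_integrable\<close>)
  moreover have "(LINT y|lborel. indicator {-N..N} y *\<^sub>R ?f y) = integral {-N..N} ?f" for N
  proof -
    have "set_integrable lborel {-N..N} ?f"
      unfolding set_integrable_def by (rule integrable_mult_indicator[OF _ int]) simp
    then show ?thesis
      using set_borel_integral_eq_integral(2)[of "{-N..N}" ?f] by (simp add: set_lebesgue_integral_def)
  qed
  ultimately show ?thesis by simp
qed

text \<open>
  Cauchy's theorem for rectangles of height tending to infinity: the decay of the integrand makes
  the two horizontal sides disappear.
\<close>

lemma vline_integral_shift:
  assumes holo: "g holomorphic_on half_plane" and a: "0 \<le> a"
    and bound: "\<And>z. 0 \<le> Re z \<Longrightarrow> Re z \<le> a \<Longrightarrow> norm (g z) \<le> K / (1 + norm z)\<^sup>2"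
  shows "vline_integral a g = vline_integral 0 g"
proof (cases "a = 0")
  case False
  with a have a: "0 < a" by simp
  have cont: "continuous_on half_plane g" using holo by (rule holomorphic_on_imp_continuous_on)
  have "0 \<le> norm (g 0)" by simp
  also have "\<dots> \<le> K" using bound[of 0] a by simp
  finally have K: "0 \<le> K" .
  let ?I = "\<lambda>b N. integral {-N..N} (\<lambda>y. g (Complex b y))"
  have cvx: "convex half_plane" using convex_halfspace_Re_ge[of 0] by simp
  have key: "norm (?I a N - ?I 0 N) \<le> 2 * a * K / (1 + N\<^sup>2)" if N: "N > 0" for N
  proof -
    let ?p = "Complex 0 (-N)" and ?q = "Complex a (-N)" and ?r = "Complex a N" and ?s = "Complex 0 N"
    have sub: "closed_segment u v \<subseteq> half_plane" if "u \<in> half_plane" "v \<in> half_plane" for u v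
      by (rule closed_segment_subset[OF that cvx])
    have ci: "g contour_integrable_on linepath u v" if "u \<in> half_plane" "v \<in> half_plane" for u v
      by (rule contour_integrable_continuous_linepath)
         (rule continuous_on_subset[OF cont sub[OF that]])
    let ?c = "\<lambda>u v. contour_integral (linepath u v) g"
    have side: "norm (?c u v) \<le> K / (1 + N\<^sup>2) * norm (v - u)"
      if uv: "0 \<le> Re u" "Re u \<le> a" "0 \<le> Re v" "Re v \<le> a" "Im u = Im v" "\<bar>Im u\<bar> = N" for u v
    proof (rule contour_integral_bound_linepath[OF ci])
      fix z assume z: "z \<in> closed_segment u v"
      have "closed_segment u v \<subseteq> {z. 0 \<le> Re z} \<inter> {z. Re z \<le> a} \<inter> ({z. Im z \<le> Im u} \<inter> {z. Im u \<le> Im z})"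
        by (rule closed_segment_subset)
           (use uv in \<open>auto intro!: convex_Int convex_halfspace_Re_le convex_halfspace_Im_le
              convex_halfspace_Im_ge cvx\<close>)
      with z have z': "0 \<le> Re z" "Re z \<le> a" and "Im z \<le> Im u" "Im u \<le> Im z" by auto
      then have Im: "Im z = Im u" by simp
      have "norm (g z) \<le> K / (1 + (Im z)\<^sup>2)"
        using bound[OF z'(1,2)] vline_decay[OF K, of z] by simp
      also have "(Im z)\<^sup>2 = N\<^sup>2" using Im uv(6) by (metis power2_abs)
      finally show "norm (g z) \<le> K / (1 + N\<^sup>2)" .
    qed (use uv K in \<open>auto simp: add_pos_nonneg\<close>)
    have h0: "(g has_contour_integral 0) (linepath ?p ?q +++ linepath ?q ?r +++ linepath ?r ?s +++ linepath ?s ?p)"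
      by (rule Cauchy_theorem_convex_simple[OF holo cvx])
         (use a sub[of ?p ?q] sub[of ?q ?r] sub[of ?r ?s] sub[of ?s ?p] in
            \<open>simp_all add: path_image_join valid_path_join\<close>)
    have h1: "(g has_contour_integral (?c ?p ?q + (?c ?q ?r + (?c ?r ?s + ?c ?s ?p))))
        (linepath ?p ?q +++ linepath ?q ?r +++ linepath ?r ?s +++ linepath ?s ?p)"
      by (intro has_contour_integral_join has_contour_integral_integral ci)
         (use a in \<open>simp_all add: valid_path_join\<close>)
    have sum0: "?c ?p ?q + (?c ?q ?r + (?c ?r ?s + ?c ?s ?p)) = 0"
      by (rule has_contour_integral_unique[OF h1 h0])
    have right: "?c ?q ?r = \<i> * ?I a N"
      by (rule contour_integral_linepath_same_Re) (use N in auto)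
    have "?c ?p ?s = \<i> * ?I 0 N"
      by (rule contour_integral_linepath_same_Re) (use N in auto)
    moreover have "?c ?s ?p = - ?c ?p ?s"
      by (rule contour_integral_reverse_linepath)
         (rule continuous_on_subset[OF cont sub], simp_all)
    ultimately have left: "?c ?s ?p = - (\<i> * ?I 0 N)" by simp
    have "Q + S = - P - R" if "P + (Q + (R + S)) = 0" for P Q R S :: complex
      using that by algebra
    from this[OF sum0] have "\<i> * (?I a N - ?I 0 N) = - ?c ?p ?q - ?c ?r ?s"
      by (simp add: right left right_diff_distrib)
    then have "norm (?I a N - ?I 0 N) = norm (- ?c ?p ?q - ?c ?r ?s)"
      by (metis mult_1 norm_ii norm_mult)
    also have "\<dots> \<le> norm (?c ?p ?q) + norm (?c ?r ?s)"
      by (metis norm_minus_cancel norm_triangle_ineq4)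
    also have "\<dots> \<le> K / (1 + N\<^sup>2) * a + K / (1 + N\<^sup>2) * a"
      using side[of ?p ?q] side[of ?r ?s] a N by (intro add_mono) (simp_all add: cmod_def)
    also have "\<dots> = 2 * a * K / (1 + N\<^sup>2)" by (simp add: field_simps)
    finally show ?thesis .
  qed
  have lim: "((\<lambda>N::real. 2 * a * K / (1 + N\<^sup>2)) \<longlongrightarrow> 0) at_top"
    by (intro tendsto_divide_0[OF tendsto_const] filterlim_at_top_imp_at_infinity) real_asymp
  have l0: "((\<lambda>N. ?I a N - ?I 0 N) \<longlongrightarrow> 0) at_top"
    by (rule Lim_null_comparison[OF _ lim])
       (rule eventually_mono[OF eventually_gt_at_top[of 0] key])
  have l1: "((\<lambda>N. ?I a N - ?I 0 N) \<longlongrightarrow> vline_integral a g - vline_integral 0 g) at_top"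
    by (intro tendsto_diff vline_integral_truncate[where K = K] bound continuous_on_subset[OF cont]) (use a in auto)
  have "vline_integral a g - vline_integral 0 g = 0"
    by (rule tendsto_unique[OF trivial_limit_at_top_linorder l1 l0])
  then show ?thesis by simp
qed simp

section \<open>Entire functions from Cauchy type integrals over vertical lines\<close>

text \<open>
  The weight of the integrals below is a power of this entire function. It is of exponential type,
  is $O(1/|z|)$ on every vertical line, and on the imaginary axis it is the real function
  $\sin(\varepsilon y)/y$, whose even powers are nonnegative.
\<close>

definition sinhc :: "real \<Rightarrow> complex \<Rightarrow> complex" where
  "sinhc \<epsilon> z = (if z = 0 then of_real \<epsilon> else sinh (of_real \<epsilon> * z) / z)"

lemma holomorphic_sinhc: "sinhc \<epsilon> holomorphic_on S"
proof -
  let ?f = "\<lambda>z::complex. sinh (of_real \<epsilon> * z)"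
  have "(?f has_field_derivative of_real \<epsilon>) (at 0)"
    by (auto intro!: derivative_eq_intros)
  then have "deriv ?f 0 = of_real \<epsilon>" by (rule DERIV_imp_deriv)
  moreover have "(\<lambda>z. if z = 0 then deriv ?f 0 else (?f z - ?f 0) / (z - 0)) holomorphic_on UNIV"
    by (rule pole_lemma_open) (auto intro!: holomorphic_intros simp: sinh_def scaleR_conv_of_real)
  moreover have "(\<lambda>z. if z = 0 then deriv ?f 0 else (?f z - ?f 0) / (z - 0)) = sinhc \<epsilon>"
    using calculation(1) by (auto simp: sinhc_def fun_eq_iff)
  ultimately show ?thesis by (metis holomorphic_on_subset subset_UNIV)
qed

lemma cnj_sinhc: "cnj (sinhc \<epsilon> z) = sinhc \<epsilon> (cnj z)"
  by (simp add: sinhc_def sinh_def exp_cnj scaleR_conv_of_real)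

lemma sinhc_imag: "sinhc \<epsilon> (Complex 0 y) = of_real (if y = 0 then \<epsilon> else sin (\<epsilon> * y) / y)"
proof (cases "y = 0")
  case False
  have "sinh (of_real \<epsilon> * Complex 0 y) = \<i> * of_real (sin (\<epsilon> * y))"
    by (simp add: sinh_def exp_eq_polar complex_eq_iff Re_exp Im_exp scaleR_conv_of_real)
  moreover have "Complex 0 y = \<i> * of_real y" by (simp add: complex_eq_iff)
  ultimately show ?thesis using False by (simp add: sinhc_def)
qed (simp add: sinhc_def zero_complex.code flip: zero_complex.code)

lemma norm_sinh_le: "0 \<le> Re z \<Longrightarrow> norm (sinh z) \<le> exp (Re z)"
proof -
  assume z: "0 \<le> Re z"
  have "norm (sinh z) = norm (exp z - exp (- z)) / 2" by (simp add: sinh_def)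
  also have "\<dots> \<le> (exp (Re z) + exp (- Re z)) / 2"
    using norm_triangle_ineq4[of "exp z" "exp (- z)"] by simp
  also have "\<dots> \<le> exp (Re z)" using z by simp
  finally show ?thesis .
qed

lemma sinhc_bound:
  assumes "0 < \<epsilon>"
  shows "\<exists>K\<ge>0. \<forall>z. 0 \<le> Re z \<longrightarrow> norm (sinhc \<epsilon> z) \<le> K * exp (\<epsilon> * Re z) / (1 + norm z)"
proof -
  have "compact (sinhc \<epsilon> ` cball 0 1)"
    by (intro compact_continuous_image holomorphic_on_imp_continuous_on holomorphic_sinhc compact_cball)
  then have "bounded (sinhc \<epsilon> ` cball 0 1)" by (rule compact_imp_bounded)
  then obtain B where "\<forall>w\<in>sinhc \<epsilon> ` cball 0 1. norm w \<le> B" unfolding bounded_iff by blast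
  then have B: "norm (sinhc \<epsilon> z) \<le> B" if "norm z \<le> 1" for z using that by simp
  let ?K = "2 * max B 1"
  have "norm (sinhc \<epsilon> z) \<le> ?K * exp (\<epsilon> * Re z) / (1 + norm z)" if z: "0 \<le> Re z" for z
  proof (cases "norm z \<le> 1")
    case True
    have "norm (sinhc \<epsilon> z) * (1 + norm z) \<le> max B 1 * 2"
      using B[OF True] True by (intro mult_mono) auto
    also have "\<dots> = ?K * 1" by simp
    also have "\<dots> \<le> ?K * exp (\<epsilon> * Re z)"
      using assms z by (intro mult_left_mono) auto
    finally show ?thesis by (simp add: pos_le_divide_eq add_pos_nonneg)
  next
    case False
    then have "z \<noteq> 0" by auto
    have "norm (sinhc \<epsilon> z) * (1 + norm z) = norm (sinh (of_real \<epsilon> * z)) * ((1 + norm z) / norm z)"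
      using \<open>z \<noteq> 0\<close> by (simp add: sinhc_def norm_divide)
    also have "\<dots> \<le> exp (\<epsilon> * Re z) * 2"
      using False assms z norm_sinh_le[of "of_real \<epsilon> * z"]
      by (intro mult_mono) (auto simp: divide_le_eq)
    also have "\<dots> = 2 * exp (\<epsilon> * Re z)" by simp
    also have "\<dots> \<le> ?K * exp (\<epsilon> * Re z)"
      by (intro mult_right_mono) auto
    finally show ?thesis by (simp add: pos_le_divide_eq add_pos_nonneg)
  qed
  then show ?thesis by (intro exI[of _ ?K]) auto
qed

text \<open>
  The data for the Cauchy type integral. The function \<open>T\<close> sends the right half-plane into a domain
  that keeps a distance from the set \<open>D\<close>; the integral will be small on \<open>D\<close> and large only inside
  the image of \<open>T\<close>. The lower bound \<open>m\<close> measures how fast the images of the lines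
  $\mathrm{Re}\,z = a$ recede to infinity as $a$ grows, which governs the growth of the integral.
  The distance to \<open>D\<close> may shrink like $1/|z|$: such losses are polynomial in $|z|$ and are absorbed
  by the weight.
\<close>

locale line_transform =
  fixes T :: "complex \<Rightarrow> complex" and m :: "real \<Rightarrow> real" and C c \<epsilon> :: real and D :: "complex set"
  assumes holo: "T holomorphic_on half_plane"
    and upper: "\<And>z. 0 \<le> Re z \<Longrightarrow> norm (T z) \<le> C * (1 + norm z)"
    and lower: "\<And>z. 0 \<le> Re z \<Longrightarrow> m (Re z) \<le> norm (T z)"
    and m_pos: "0 < m 0" and m_mono: "mono_on {0..} m" and m_top: "filterlim m at_top at_top"
    and symmetric: "\<And>z. 0 \<le> Re z \<Longrightarrow> T (cnj z) = cnj (T z)"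
    and far: "\<And>z \<zeta>. 0 \<le> Re z \<Longrightarrow> \<zeta> \<in> D \<Longrightarrow> c \<le> norm (T z - \<zeta>) * (1 + norm z)"
    and c_pos: "0 < c" and \<epsilon>_pos: "0 < \<epsilon>"
begin

text \<open>
  The integrands below contain factors of order up to $|z|^3$ and have to decay like $|z|^{-2}$, so the
  exponent must be at least 5; an even exponent makes the weight nonnegative on the imaginary axis.
\<close>

definition weight :: "complex \<Rightarrow> complex" where
  "weight z = sinhc \<epsilon> z ^ 6"

definition weight_const :: real where
  "weight_const = (SOME K. 0 \<le> K \<and>
     (\<forall>z. 0 \<le> Re z \<longrightarrow> norm (weight z) \<le> K * exp (6 * \<epsilon> * Re z) / (1 + norm z) ^ 6))"

lemma weight_const: "0 \<le> weight_const"
  and weight_bound: "0 \<le> Re z \<Longrightarrow> norm (weight z) \<le> weight_const * exp (6 * \<epsilon> * Re z) / (1 + norm z) ^ 6"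
proof -
  obtain K where K: "0 \<le> K" "\<And>z. 0 \<le> Re z \<Longrightarrow> norm (sinhc \<epsilon> z) \<le> K * exp (\<epsilon> * Re z) / (1 + norm z)"
    using sinhc_bound[OF \<epsilon>_pos] by blast
  have "norm (weight z) \<le> K ^ 6 * exp (6 * \<epsilon> * Re z) / (1 + norm z) ^ 6" if z: "0 \<le> Re z" for z
  proof -
    have "norm (weight z) = norm (sinhc \<epsilon> z) ^ 6"
      by (simp add: weight_def norm_power)
    also have "\<dots> \<le> (K * exp (\<epsilon> * Re z) / (1 + norm z)) ^ 6"
      by (rule power_mono[OF K(2)[OF z]]) simp
    also have "\<dots> = K ^ 6 * exp (6 * \<epsilon> * Re z) / (1 + norm z) ^ 6"
      using exp_of_nat_mult[of 6 "\<epsilon> * Re z"] by (simp add: power_divide power_mult_distrib mult.assoc)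
    finally show ?thesis .
  qed
  then have "\<exists>K. 0 \<le> K \<and>
     (\<forall>z. 0 \<le> Re z \<longrightarrow> norm (weight z) \<le> K * exp (6 * \<epsilon> * Re z) / (1 + norm z) ^ 6)"
    using K(1) by (intro exI[of _ "K ^ 6"]) auto
  from someI_ex[OF this]
  show "0 \<le> weight_const"
    and "0 \<le> Re z \<Longrightarrow> norm (weight z) \<le> weight_const * exp (6 * \<epsilon> * Re z) / (1 + norm z) ^ 6"
    unfolding weight_const_def by auto
qed

lemma holomorphic_weight: "weight holomorphic_on S"
  unfolding weight_def by (intro holomorphic_intros holomorphic_sinhc)

lemma T_lower: "0 \<le> a \<Longrightarrow> a \<le> Re z \<Longrightarrow> m a \<le> norm (T z)"
  using lower[of z] monotone_onD[OF m_mono, of a "Re z"] by simp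

lemma T_nonzero: "0 \<le> Re z \<Longrightarrow> T z \<noteq> 0"
  using T_lower[of 0 z] m_pos by auto

lemma weight_mult_bound:
  assumes z: "0 \<le> Re z" "Re z \<le> a" and q: "norm q \<le> B * (1 + norm z) ^ 4" and B: "0 \<le> B"
  shows "norm (weight z * q) \<le> (weight_const * exp (6 * \<epsilon> * a) * B) / (1 + norm z)\<^sup>2"
proof -
  have pos: "0 < 1 + norm z" by (simp add: add_pos_nonneg)
  have "weight_const * exp (6 * \<epsilon> * Re z) \<le> weight_const * exp (6 * \<epsilon> * a)"
    using z \<epsilon>_pos weight_const by (intro mult_left_mono) auto
  then have "norm (weight z) \<le> weight_const * exp (6 * \<epsilon> * a) / (1 + norm z) ^ 6"
    using weight_bound[OF z(1)] pos by (meson divide_right_mono order_trans zero_le_power less_imp_le)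
  then have "norm (weight z * q) \<le> weight_const * exp (6 * \<epsilon> * a) / (1 + norm z) ^ 6 * (B * (1 + norm z) ^ 4)"
    unfolding norm_mult using q weight_const pos by (intro mult_mono) auto
  also have "\<dots> = (weight_const * exp (6 * \<epsilon> * a) * B) * ((1 + norm z) ^ 4 / (1 + norm z) ^ 6)"
    by simp
  also have "(1 + norm z) ^ 4 / (1 + norm z) ^ 6 = 1 / (1 + norm z)\<^sup>2"
  proof -
    have split: "(1 + norm z) ^ 6 = (1 + norm z) ^ 4 * (1 + norm z)\<^sup>2"
      by (simp flip: power_add)
    have "(1 + norm z) ^ 4 \<noteq> 0" using pos by simp
    then show ?thesis unfolding split by (rule nonzero_divide_mult_cancel_left)
  qed
  finally show ?thesis by simp
qed

lemma weight_bounded_bound: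
  assumes z: "0 \<le> Re z" "Re z \<le> a" and q: "norm q \<le> B" and B: "0 \<le> B"
  shows "norm (weight z * q) \<le> (weight_const * exp (6 * \<epsilon> * a) * B) / (1 + norm z)\<^sup>2"
proof (rule weight_mult_bound[OF z _ B])
  have "1 \<le> (1 + norm z) ^ 4" by (rule one_le_power) simp
  then have "B * 1 \<le> B * (1 + norm z) ^ 4" using B by (intro mult_left_mono)
  then show "norm q \<le> B * (1 + norm z) ^ 4" using q by simp
qed

text \<open>
  Expanding \<open>kernel\<close> in powers of \<open>\<zeta>\<close> gives the integrands of \<open>coeff\<close>. They have no singularity in
  the right half-plane, so the coefficients can be computed on any vertical line, whereas the
  kernel has poles at the solutions of \<open>T z = \<zeta>\<close>.
\<close>

definition coeff :: "nat \<Rightarrow> complex" where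
  "coeff n = vline_integral 0 (\<lambda>z. weight z * (1 / T z) ^ n)"

definition kernel :: "complex \<Rightarrow> complex \<Rightarrow> complex" where
  "kernel \<zeta> z = weight z * (T z / (T z - \<zeta>))"

lemma holomorphic_coeff_integrand: "(\<lambda>z. weight z * (1 / T z) ^ n) holomorphic_on half_plane"
  by (intro holomorphic_intros holomorphic_weight holo) (use T_nonzero in auto)

lemma coeff_integrand_bound:
  assumes z: "0 \<le> Re z" "Re z \<le> a"
  shows "norm (weight z * (1 / T z) ^ n)
          \<le> (weight_const * exp (6 * \<epsilon> * a) * (1 / m 0) ^ n) / (1 + norm z)\<^sup>2"
proof (rule weight_bounded_bound[OF z])
  have "norm (1 / T z) \<le> 1 / m 0"
    using z m_pos T_lower[of 0 z] by (simp add: norm_divide frac_le)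
  then show "norm ((1 / T z) ^ n) \<le> (1 / m 0) ^ n"
    unfolding norm_power by (rule power_mono) simp
qed (use m_pos in simp)

lemma integrable_coeff_integrand:
  assumes "0 \<le> a"
  shows "integrable lborel (\<lambda>y. weight (Complex a y) * (1 / T (Complex a y)) ^ n)"
proof (rule vline_integrable[where g = "\<lambda>z. weight z * (1 / T z) ^ n"])
  have "{z. Re z = a} \<subseteq> half_plane" using assms by auto
  then show "continuous_on {z. Re z = a} (\<lambda>z. weight z * (1 / T z) ^ n)"
    using holomorphic_on_imp_continuous_on[OF holomorphic_coeff_integrand] continuous_on_subset by blast
  show "norm (weight (Complex a y) * (1 / T (Complex a y)) ^ n)
      \<le> (weight_const * exp (6 * \<epsilon> * a) * (1 / m 0) ^ n) / (1 + norm (Complex a y))\<^sup>2" for y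
    using assms by (intro coeff_integrand_bound) auto
qed

lemma coeff_shift:
  assumes a: "0 \<le> a"
  shows "vline_integral a (\<lambda>z. weight z * (1 / T z) ^ n) = coeff n"
  unfolding coeff_def
  by (rule vline_integral_shift[OF holomorphic_coeff_integrand a coeff_integrand_bound])

lemma near_bound:
  assumes a: "0 \<le> a" and \<zeta>: "2 * norm \<zeta> \<le> m a" and z: "Re z = a"
  shows "norm (\<zeta> / T z) \<le> 1 / 2" "T z \<noteq> \<zeta>" "norm (T z / (T z - \<zeta>)) \<le> 2"
proof -
  have T: "m a \<le> norm (T z)" and T0: "T z \<noteq> 0" using T_lower[of a z] T_nonzero[of z] a z by auto
  show q: "norm (\<zeta> / T z) \<le> 1 / 2"
    using T \<zeta> T0 by (simp add: norm_divide divide_le_eq)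
  then show ne: "T z \<noteq> \<zeta>" using T0 by auto
  have "norm (T z) / 2 \<le> norm (T z) - norm \<zeta>" using T \<zeta> by simp
  also have "\<dots> \<le> norm (T z - \<zeta>)" by (rule norm_triangle_ineq2)
  finally show "norm (T z / (T z - \<zeta>)) \<le> 2"
    using ne by (simp add: norm_divide divide_le_eq)
qed

text \<open>
  On a line where $|T| \ge 2|\zeta|$ the geometric series for $1/(1 - \zeta/T)$ converges uniformly. As
  the coefficients do not depend on the line, the sum of one and the same power series is given by
  the integral over each line that is far enough to the right, and it inherits the bound of
  the weight on that line.
\<close>

lemma coeff_sums:
  assumes a: "0 \<le> a" and \<zeta>: "2 * norm \<zeta> \<le> m a"
  shows "(\<lambda>n. coeff n * \<zeta> ^ n) sums vline_integral a (kernel \<zeta>)"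
    and "norm (vline_integral a (kernel \<zeta>))
           \<le> weight_const * exp (6 * \<epsilon> * a) * 2 * (LINT y|lborel. 1 / (1 + y\<^sup>2))"
proof -
  let ?I = "LINT y|lborel. 1 / (1 + y\<^sup>2) :: real"
  let ?K = "weight_const * exp (6 * \<epsilon> * a)"
  let ?t = "\<lambda>n z. weight z * (1 / T z) ^ n"
  have sub: "{z. Re z = a} \<subseteq> half_plane" using a by auto
  note near = near_bound[OF a \<zeta>]
  have contT: "continuous_on {z. Re z = a} T" and contW: "continuous_on {z. Re z = a} weight"
    using holo holomorphic_weight sub by (meson holomorphic_on_imp_continuous_on holomorphic_on_subset)+
  have contR: "continuous_on {z. Re z = a} (\<lambda>z. weight z * ((\<zeta> / T z) ^ N * (T z / (T z - \<zeta>))))" for N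
    using near(2) T_nonzero a by (intro continuous_intros contT contW) auto
  have contK: "continuous_on {z. Re z = a} (kernel \<zeta>)"
    using contR[of 0] by (simp add: kernel_def[abs_def])
  have boundR: "norm (weight z * ((\<zeta> / T z) ^ N * (T z / (T z - \<zeta>)))) \<le> (?K * ((1/2) ^ N * 2)) / (1 + norm z)\<^sup>2"
    if z: "Re z = a" for z N
  proof (rule weight_bounded_bound)
    have "norm (\<zeta> / T z) ^ N \<le> (1/2) ^ N" by (rule power_mono[OF near(1)[OF z]]) simp
    then show "norm ((\<zeta> / T z) ^ N * (T z / (T z - \<zeta>))) \<le> (1/2) ^ N * 2"
      unfolding norm_mult norm_power using near(3)[OF z] by (intro mult_mono) auto
  qed (use z a in auto)
  have boundK: "norm (kernel \<zeta> z) \<le> (?K * 2) / (1 + norm z)\<^sup>2" if z: "Re z = a" for z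
    using boundR[OF z, of 0] by (simp add: kernel_def)
  have intK: "integrable lborel (\<lambda>y. kernel \<zeta> (Complex a y))"
    by (rule vline_integrable[OF contK boundK]) simp
  have intT: "integrable lborel (\<lambda>y. ?t n (Complex a y))" for n
    by (rule integrable_coeff_integrand[OF a])
  have diff: "vline_integral a (kernel \<zeta>) - (\<Sum>n<N. coeff n * \<zeta> ^ n)
      = vline_integral a (\<lambda>z. weight z * ((\<zeta> / T z) ^ N * (T z / (T z - \<zeta>))))" for N
  proof -
    have "(\<Sum>n<N. coeff n * \<zeta> ^ n) = (\<Sum>n<N. LINT y|lborel. ?t n (Complex a y) * \<zeta> ^ n)"
      using coeff_shift[OF a] unfolding vline_integral_def by (simp add: intT)
    also have "\<dots> = (LINT y|lborel. (\<Sum>n<N. ?t n (Complex a y) * \<zeta> ^ n))"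
      by (rule Bochner_Integration.integral_sum[symmetric]) (intro integrable_mult_left intT)
    finally have "vline_integral a (kernel \<zeta>) - (\<Sum>n<N. coeff n * \<zeta> ^ n)
        = (LINT y|lborel. kernel \<zeta> (Complex a y) - (\<Sum>n<N. ?t n (Complex a y) * \<zeta> ^ n))"
      unfolding vline_integral_def
      by (simp add: Bochner_Integration.integral_diff intK intT)
    also have "\<dots> = vline_integral a (\<lambda>z. weight z * ((\<zeta> / T z) ^ N * (T z / (T z - \<zeta>))))"
      unfolding vline_integral_def
    proof (rule Bochner_Integration.integral_cong[OF refl])
      fix y
      define z where "z = Complex a y"
      have z: "Re z = a" by (simp add: z_def)
      define q where "q = \<zeta> / T z"
      have T0: "T z \<noteq> 0" using T_nonzero[of z] a z by simp
      have q1: "q \<noteq> 1" using near(1)[OF z] by (auto simp: q_def)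
      have q: "T z / (T z - \<zeta>) = 1 / (1 - q)" using T0 near(2)[OF z] by (simp add: q_def field_simps)
      have "(\<Sum>n<N. ?t n z * \<zeta> ^ n) = weight z * (\<Sum>n<N. q ^ n)"
        by (simp add: sum_distrib_left q_def power_divide mult.assoc)
      also have "(\<Sum>n<N. q ^ n) = (1 - q ^ N) / (1 - q)"
        using q1 by (simp add: sum_gp_strict)
      finally have "kernel \<zeta> z - (\<Sum>n<N. ?t n z * \<zeta> ^ n) = weight z * (1 / (1 - q)) - weight z * ((1 - q ^ N) / (1 - q))"
        unfolding kernel_def q by simp
      also have "\<dots> = weight z * (q ^ N * (1 / (1 - q)))"
        by (simp add: right_diff_distrib diff_divide_distrib)
      finally show "kernel \<zeta> (Complex a y) - (\<Sum>n<N. ?t n (Complex a y) * \<zeta> ^ n)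
          = weight (Complex a y) * ((\<zeta> / T (Complex a y)) ^ N * (T (Complex a y) / (T (Complex a y) - \<zeta>)))"
        unfolding z_def[symmetric] q_def[symmetric] q .
    qed
    finally show ?thesis .
  qed
  have rem: "norm (vline_integral a (kernel \<zeta>) - (\<Sum>n<N. coeff n * \<zeta> ^ n)) \<le> (?K * ((1/2) ^ N * 2)) * ?I" for N
    unfolding diff by (rule vline_integral_norm_le[OF contR _ boundR]) (use weight_const in auto)
  have "(\<lambda>N. (?K * ((1/2) ^ N * 2)) * ?I) \<longlonglongrightarrow> (?K * (0 * 2)) * ?I"
    by (intro tendsto_intros LIMSEQ_power_zero) auto
  then have "(\<lambda>N. vline_integral a (kernel \<zeta>) - (\<Sum>n<N. coeff n * \<zeta> ^ n)) \<longlonglongrightarrow> 0"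
    by (intro Lim_null_comparison[OF always_eventually[OF allI[OF rem]]]) simp
  from tendsto_diff[OF tendsto_const[of "vline_integral a (kernel \<zeta>)"] this]
  show "(\<lambda>n. coeff n * \<zeta> ^ n) sums vline_integral a (kernel \<zeta>)"
    by (simp add: sums_def)
  show "norm (vline_integral a (kernel \<zeta>)) \<le> ?K * 2 * ?I"
    using rem[of 0] by simp
qed

text \<open>
  The power series, rather than the integral, defines the entire function: the integral over a fixed
  line represents it only on the complement of the image of the half-plane to the right of that line.
\<close>

definition transform :: "complex \<Rightarrow> complex" where
  "transform \<zeta> = (\<Sum>n. coeff n * \<zeta> ^ n)"

lemma transform_eq: "0 \<le> a \<Longrightarrow> 2 * norm \<zeta> \<le> m a \<Longrightarrow> transform \<zeta> = vline_integral a (kernel \<zeta>)"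
  unfolding transform_def using coeff_sums(1) by (simp add: sums_iff)

lemma reach: "\<exists>a\<ge>0. r \<le> m a"
proof -
  have "\<forall>\<^sub>F a in at_top. r \<le> m a" using m_top by (simp add: filterlim_at_top)
  then obtain N where N: "\<And>a. N \<le> a \<Longrightarrow> r \<le> m a" by (auto simp: eventually_at_top_linorder)
  show ?thesis by (rule exI[of _ "max N 0"]) (simp add: N)
qed

lemma transform_sums: "(\<lambda>n. coeff n * \<zeta> ^ n) sums transform \<zeta>"
  using reach[of "2 * norm \<zeta>"] coeff_sums(1) transform_eq by metis

lemma holomorphic_transform: "transform holomorphic_on S"
proof -
  have "transform holomorphic_on ball 0 r" for r
    by (rule power_series_holomorphic) (use transform_sums in simp)
  then have "transform analytic_on ball 0 r" for r by (simp add: analytic_on_open)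
  then have "transform analytic_on (\<Union>n::nat. ball 0 (real n))" by (auto simp: analytic_on_UN)
  moreover have "(\<Union>n::nat. ball (0::complex) (real n)) = UNIV"
    using reals_Archimedean2 by auto
  ultimately show ?thesis by (metis analytic_imp_holomorphic holomorphic_on_subset subset_UNIV)
qed

lemma cnj_coeff: "cnj (coeff n) = coeff n"
proof -
  let ?f = "\<lambda>z. weight z * (1 / T z) ^ n"
  have "cnj (?f (Complex 0 y)) = ?f (Complex 0 (-y))" for y
  proof -
    have "Complex 0 (-y) = cnj (Complex 0 y)" by (simp add: complex_eq_iff)
    then show ?thesis using symmetric[of "Complex 0 y"] by (simp add: weight_def cnj_sinhc)
  qed
  then have "cnj (coeff n) = (LINT y|lborel. ?f (Complex 0 (-y)))"
    unfolding coeff_def vline_integral_def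
    using integral_bounded_linear[OF bounded_linear_cnj integrable_coeff_integrand[of 0 n]] by simp
  also have "\<dots> = coeff n"
    unfolding coeff_def vline_integral_def
    by (subst (2) lborel_integral_real_affine[of "-1" _ 0]) auto
  finally show ?thesis .
qed

lemma transform_real: "Im (transform (of_real x)) = 0"
proof -
  have "(\<lambda>n. cnj (coeff n * of_real x ^ n)) sums cnj (transform (of_real x))"
    by (rule sums_cnj[THEN iffD2, OF transform_sums])
  then have "cnj (transform (of_real x)) = transform (of_real x)"
    using transform_sums[of "of_real x"] by (simp add: cnj_coeff sums_unique2)
  then show ?thesis by (metis Im_complex_of_real Reals_cnj_iff complex_is_Real_iff)
qed

text \<open>
  The value at 0 is the integral of the weight, which on the imaginary axis is the sixth power of
  $\sin(\varepsilon y)/y$.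
\<close>

lemma transform_0_nonzero: "transform 0 \<noteq> 0"
proof
  let ?s = "\<lambda>y. (if y = 0 then \<epsilon> else sin (\<epsilon> * y) / y) ^ 6"
  assume "transform 0 = 0"
  moreover have "transform 0 = coeff 0" by (simp add: transform_def)
  moreover have "coeff 0 = (LINT y|lborel. complex_of_real (?s y))"
    by (simp add: coeff_def vline_integral_def weight_def sinhc_imag)
  ultimately have zero: "(LINT y|lborel. ?s y) = 0" by (simp only: integral_complex_of_real of_real_eq_0_iff)
  have "integrable lborel (\<lambda>y. weight (Complex 0 y) * 1)"
    by (rule vline_integrable[OF _ weight_bounded_bound[where B = 1 and a = 0]])
       (auto intro!: holomorphic_on_imp_continuous_on holomorphic_weight)
  then have "integrable lborel (\<lambda>y. complex_of_real (?s y))"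
    by (simp add: weight_def sinhc_imag)
  then have "integrable lborel ?s" by (simp only: complex_of_real_integrable_eq)
  with zero have AE0: "AE y in lborel. ?s y = 0"
    by (subst (asm) integral_nonneg_eq_0_iff_AE) auto
  have "AE y in lborel. y \<notin> {0<..<pi / \<epsilon>}"
    using AE0
  proof eventually_elim
    case (elim y)
    show ?case
    proof
      assume y: "y \<in> {0<..<pi / \<epsilon>}"
      then have "0 < \<epsilon> * y" "\<epsilon> * y < pi" using \<epsilon>_pos by (auto simp: field_simps)
      then have "0 < sin (\<epsilon> * y)" by (rule sin_gt_zero)
      then show False using elim y by auto
    qed
  qed
  then have "emeasure lborel {0<..<pi / \<epsilon>} = 0"
    by (subst (asm) AE_iff_measurable[of "{0<..<pi / \<epsilon>}"]) auto
  then show False using \<epsilon>_pos by simp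
qed

lemma transform_growth:
  assumes "0 \<le> a" "2 * norm \<zeta> \<le> m a"
  shows "norm (transform \<zeta>) \<le> weight_const * 2 * (LINT y|lborel. 1 / (1 + y\<^sup>2)) * exp (6 * \<epsilon> * a)"
  using coeff_sums(2)[OF assms] by (simp add: transform_eq[OF assms] mult_ac)

lemma C_nonneg: "0 \<le> C"
  using order_trans[OF norm_ge_zero upper[of 0]] by simp

text \<open>
  If \<open>\<zeta>\<close> lies in \<open>D\<close>, the kernel has no pole in the right half-plane, and the line of integration
  can be moved back to the imaginary axis. There the identity
  $\zeta\,T/(T-\zeta) = T\,(T/(T-\zeta) - 1)$ bounds the product of \<open>\<zeta>\<close> and the kernel uniformly in \<open>\<zeta>\<close>.
\<close>

lemma transform_decay:
  assumes \<zeta>: "\<zeta> \<in> D"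
  shows "norm (transform \<zeta>) * norm \<zeta> \<le> weight_const * (C * (C / c + 1)) * (LINT y|lborel. 1 / (1 + y\<^sup>2))"
proof -
  have ratio: "norm (T z / (T z - \<zeta>)) \<le> C / c * (1 + norm z)\<^sup>2" and ne: "T z \<noteq> \<zeta>" if z: "0 \<le> Re z" for z
  proof -
    have pos: "0 < norm (T z - \<zeta>) * (1 + norm z)" using far[OF z \<zeta>] c_pos by simp
    then show ne: "T z \<noteq> \<zeta>" by auto
    have "norm (T z) * c \<le> (C * (1 + norm z)) * (norm (T z - \<zeta>) * (1 + norm z))"
      using upper[OF z] far[OF z \<zeta>] C_nonneg c_pos by (intro mult_mono) auto
    then show "norm (T z / (T z - \<zeta>)) \<le> C / c * (1 + norm z)\<^sup>2"
      using ne c_pos by (simp add: norm_divide field_simps power2_eq_square)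
  qed
  have one: "1 \<le> 1 + norm z" for z :: complex by simp
  have holK: "kernel \<zeta> holomorphic_on half_plane"
    unfolding kernel_def by (intro holomorphic_intros holomorphic_weight holo) (use ne in auto)
  obtain a where a: "0 \<le> a" "2 * norm \<zeta> \<le> m a" using reach by blast
  have "transform \<zeta> = vline_integral a (kernel \<zeta>)" by (rule transform_eq[OF a])
  also have "\<dots> = vline_integral 0 (kernel \<zeta>)"
  proof (rule vline_integral_shift[OF holK a(1)])
    fix z assume z: "0 \<le> Re z" "Re z \<le> a"
    have "(1 + norm z)\<^sup>2 \<le> (1 + norm z) ^ 4" by (rule power_increasing) auto
    then have "C / c * (1 + norm z)\<^sup>2 \<le> C / c * (1 + norm z) ^ 4"
      using C_nonneg c_pos by (intro mult_left_mono) auto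
    with ratio[OF z(1)] show "norm (kernel \<zeta> z) \<le> (weight_const * exp (6 * \<epsilon> * a) * (C / c)) / (1 + norm z)\<^sup>2"
      unfolding kernel_def using z C_nonneg c_pos by (intro weight_mult_bound) auto
  qed
  finally have eq: "transform \<zeta> * \<zeta> = vline_integral 0 (\<lambda>z. kernel \<zeta> z * \<zeta>)"
    by (simp add: vline_integral_def)
  have "norm (vline_integral 0 (\<lambda>z. kernel \<zeta> z * \<zeta>))
      \<le> weight_const * (C * (C / c + 1)) * (LINT y|lborel. 1 / (1 + y\<^sup>2))"
  proof (rule vline_integral_norm_le)
    show "continuous_on {z. Re z = 0} (\<lambda>z. kernel \<zeta> z * \<zeta>)"
      by (intro continuous_intros continuous_on_subset[OF holomorphic_on_imp_continuous_on[OF holK]]) auto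
    show "0 \<le> weight_const * (C * (C / c + 1))" using weight_const C_nonneg c_pos by simp
    fix y
    define z where "z = Complex 0 y"
    have z: "0 \<le> Re z" "Re z \<le> 0" by (simp_all add: z_def)
    have "norm \<zeta> * norm (T z / (T z - \<zeta>)) = norm (T z) * norm (\<zeta> / (T z - \<zeta>))"
      by (simp add: norm_divide)
    also have "\<zeta> / (T z - \<zeta>) = T z / (T z - \<zeta>) - 1" using ne[OF z(1)] by (simp add: field_simps)
    also have "norm (T z / (T z - \<zeta>) - 1) \<le> norm (T z / (T z - \<zeta>)) + 1"
      using norm_triangle_ineq4[of "T z / (T z - \<zeta>)" 1] by simp
    also have "\<dots> \<le> C / c * (1 + norm z)\<^sup>2 + 1 * (1 + norm z)\<^sup>2"
      using ratio[OF z(1)] one_le_power[OF one[of z], of 2] by linarith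
    also have "\<dots> = (C / c + 1) * (1 + norm z)\<^sup>2" by (simp add: distrib_right)
    finally have "norm \<zeta> * norm (T z / (T z - \<zeta>)) \<le> norm (T z) * ((C / c + 1) * (1 + norm z)\<^sup>2)"
      by (simp add: mult_left_mono)
    also have "\<dots> \<le> (C * (1 + norm z)) * ((C / c + 1) * (1 + norm z)\<^sup>2)"
      using upper[OF z(1)] C_nonneg c_pos by (intro mult_right_mono) auto
    also have "\<dots> = (C * (C / c + 1)) * (1 + norm z) ^ 3" by (simp add: power3_eq_cube power2_eq_square)
    also have "\<dots> \<le> (C * (C / c + 1)) * (1 + norm z) ^ 4"
      using C_nonneg c_pos by (intro mult_left_mono power_increasing) auto
    finally have q: "norm (T z / (T z - \<zeta>) * \<zeta>) \<le> (C * (C / c + 1)) * (1 + norm z) ^ 4"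
      by (simp only: norm_mult mult.commute[of "norm \<zeta>"])
    have "0 \<le> C * (C / c + 1)" using C_nonneg c_pos by simp
    from weight_mult_bound[OF z q this]
    show "norm (kernel \<zeta> (Complex 0 y) * \<zeta>) \<le> weight_const * (C * (C / c + 1)) / (1 + norm (Complex 0 y))\<^sup>2"
      unfolding z_def[symmetric] kernel_def by (simp only: mult.assoc mult_zero_right exp_zero mult_1)
  qed
  then show ?thesis by (simp flip: eq norm_mult)
qed

end

section \<open>From entire functions to harmonic functions in the disc\<close>

text \<open>
  The conformal map of the disc onto the upper half-plane that sends 1 to infinity. Its composition
  with \<open>disc_map 0\<close> is $w \mapsto -1/w$.
\<close>

definition cayley :: "complex \<Rightarrow> complex" where
  "cayley z = \<i> * (1 + z) / (1 - z)"

lemma harmonic_on_Im: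
  assumes F: "F holomorphic_on S" and S: "open S"
  shows "harmonic_on S (\<lambda>z. Im (F z))"
proof -
  let ?F' = "deriv F" and ?F'' = "deriv (deriv F)"
  have F': "?F' holomorphic_on S" and F'': "?F'' holomorphic_on S"
    using F S by (auto intro!: holomorphic_deriv)
  have re: "((\<lambda>z. Re (g z)) has_derivative (\<lambda>w. Re (deriv g z) * Re w - Im (deriv g z) * Im w)) (at z)"
    and im: "((\<lambda>z. Im (g z)) has_derivative (\<lambda>w. Im (deriv g z) * Re w + Re (deriv g z) * Im w)) (at z)"
    if "g holomorphic_on S" "z \<in> S" for g z
  proof -
    have "(g has_field_derivative deriv g z) (at z)"
      by (rule holomorphic_derivI[OF that(1) S that(2)])
    then have d: "(g has_derivative (*) (deriv g z)) (at z)" by (simp add: has_field_derivative_def)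
    show "((\<lambda>z. Re (g z)) has_derivative (\<lambda>w. Re (deriv g z) * Re w - Im (deriv g z) * Im w)) (at z)"
      using bounded_linear.has_derivative[OF bounded_linear_Re d] by simp
    show "((\<lambda>z. Im (g z)) has_derivative (\<lambda>w. Im (deriv g z) * Re w + Re (deriv g z) * Im w)) (at z)"
      using bounded_linear.has_derivative[OF bounded_linear_Im d] by (simp add: add.commute)
  qed
  have c: "continuous_on S ?F''" using F'' by (rule holomorphic_on_imp_continuous_on)
  show ?thesis
    unfolding harmonic_on_def
  proof (rule conjI[OF S], rule exI[of _ "\<lambda>z. Im (?F' z)"], rule exI[of _ "\<lambda>z. Re (?F' z)"],
      rule exI[of _ "\<lambda>z. Im (?F'' z)"], rule exI[of _ "\<lambda>z. Re (?F'' z)"],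
      rule exI[of _ "\<lambda>z. Re (?F'' z)"], rule exI[of _ "\<lambda>z. - Im (?F'' z)"], intro conjI ballI)
  qed (simp_all add: re im F F' c continuous_on_Re continuous_on_Im continuous_on_minus)
qed

lemma norm_cayley_le: "norm z < 1 \<Longrightarrow> norm (cayley z) \<le> 2 / (1 - norm z)"
proof -
  assume z: "norm z < 1"
  have "norm (1 + z) \<le> 2" using norm_triangle_ineq[of 1 z] z by simp
  moreover have "1 - norm z \<le> norm (1 - z)" using norm_triangle_ineq2[of 1 z] by simp
  ultimately show ?thesis using z by (simp add: cayley_def norm_mult norm_divide frac_le)
qed

lemma Im_cayley: "z \<noteq> 1 \<Longrightarrow> Im (cayley z) = (1 - (norm z)\<^sup>2) / (norm (1 - z))\<^sup>2"
proof -
  have "cayley z = \<i> * (1 + z) * cnj (1 - z) / of_real ((norm (1 - z))\<^sup>2)"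
    unfolding cayley_def by (subst complex_div_cnj) simp
  then have "Im (cayley z) = Im (\<i> * (1 + z) * cnj (1 - z)) / (norm (1 - z))\<^sup>2"
    by (simp only: Im_divide_of_real)
  also have "Im (\<i> * (1 + z) * cnj (1 - z)) = 1 - (norm z)\<^sup>2"
    unfolding cmod_power2 by (simp add: algebra_simps power2_eq_square)
  finally show ?thesis .
qed

lemma cayley_surj:
  assumes "0 < Im \<zeta>"
  shows "\<exists>z\<in>unit_disc. cayley z = \<zeta>"
proof
  have ne: "\<zeta> + \<i> \<noteq> 0" using assms by (auto simp: complex_eq_iff)
  have "norm (\<zeta> - \<i>) < norm (\<zeta> + \<i>)"
    using assms by (simp add: cmod_def power2_eq_square algebra_simps)
  then show "(\<zeta> - \<i>) / (\<zeta> + \<i>) \<in> unit_disc" using ne by (simp add: norm_divide divide_less_eq)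
  show "cayley ((\<zeta> - \<i>) / (\<zeta> + \<i>)) = \<zeta>"
  proof -
    have "1 + (\<zeta> - \<i>) / (\<zeta> + \<i>) = 2 * \<zeta> / (\<zeta> + \<i>)"
      and "1 - (\<zeta> - \<i>) / (\<zeta> + \<i>) = 2 * \<i> / (\<zeta> + \<i>)"
      using ne by (simp_all add: field_simps)
    then show ?thesis using ne by (simp add: cayley_def)
  qed
qed

lemma holomorphic_cayley: "cayley holomorphic_on - {1}"
  unfolding cayley_def by (intro holomorphic_intros) auto

lemma cayley_disc_map:
  assumes "exp (\<i> * of_real \<phi>) = 1" "0 < Im w"
  shows "cayley (disc_map \<phi> w) = - 1 / w" "w = \<i> * (1 - disc_map \<phi> w) / (1 + disc_map \<phi> w)"
proof -
  have "\<i> + w \<noteq> 0" "w \<noteq> 0" using assms(2) by (auto simp: complex_eq_iff)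
  then show "cayley (disc_map \<phi> w) = - 1 / w" "w = \<i> * (1 - disc_map \<phi> w) / (1 + disc_map \<phi> w)"
    using assms(1) by (simp_all add: cayley_def disc_map_def divide_simps)
qed

text \<open>
  At a point of the circle other than 1 the function extends continuously, with the value
  $\mathrm{Im}\,F$ at a real point, which is 0. Only the approach to 1 is a condition, and there
  $z \to 1$ means $w \to 0$.
\<close>

lemma vanishing_approach_limits_cayley:
  assumes F: "F holomorphic_on UNIV" and real: "\<And>x. Im (F (of_real x)) = 0"
    and lim: "\<And>e. 0 < e \<Longrightarrow> \<exists>d>0. \<forall>w\<in>approach_Delta h. norm w < d \<longrightarrow> \<bar>Im (F (- 1 / w))\<bar> < e"
  shows "vanishing_approach_limits h (\<lambda>z. Im (F (cayley z)))"
  unfolding vanishing_approach_limits_def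
proof
  fix \<phi> assume "\<phi> \<in> {0..2*pi}"
  define p where "p = exp (\<i> * of_real \<phi>)"
  have norm_p: "norm p = 1" by (simp add: p_def)
  have "((\<lambda>z. Im (F (cayley z))) \<longlongrightarrow> 0) (at p within approach_Omega h \<phi>)"
  proof (cases "p = 1")
    case False
    have "isCont cayley p"
      using holomorphic_on_imp_continuous_on[OF holomorphic_cayley] False
      by (simp add: continuous_on_eq_continuous_at open_Compl)
    moreover have "isCont F (cayley p)"
      using holomorphic_on_imp_continuous_on[OF F] by (simp add: continuous_on_eq_continuous_at)
    ultimately have "isCont (\<lambda>z. Im (F (cayley z))) p"
      by (intro isCont_Im isCont_o2[of p cayley F])
    then have "((\<lambda>z. Im (F (cayley z))) \<longlongrightarrow> Im (F (cayley p))) (at p)"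
      by (simp add: isCont_def)
    moreover have "Im (cayley p) = 0" using Im_cayley[OF False] norm_p by simp
    then have "cayley p = of_real (Re (cayley p))" by (simp add: complex_eq_iff)
    then have "Im (F (cayley p)) = 0" using real by metis
    ultimately have "((\<lambda>z. Im (F (cayley z))) \<longlongrightarrow> 0) (at p)" by simp
    then show ?thesis by (rule tendsto_mono[OF at_le[OF subset_UNIV]])
  next
    case True
    show ?thesis
      unfolding tendsto_iff eventually_at
    proof (intro allI impI)
      fix e :: real assume "0 < e"
      then obtain d where d: "0 < d" "\<And>w. w \<in> approach_Delta h \<Longrightarrow> norm w < d \<Longrightarrow> \<bar>Im (F (- 1 / w))\<bar> < e"
        using lim by blast
      have "dist (Im (F (cayley z))) 0 < e"
        if z: "z \<in> approach_Omega h \<phi>" "dist z p < min d 1" for z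
      proof -
        obtain w where w: "w \<in> approach_Delta h" "z = disc_map \<phi> w"
          using z(1) by (auto simp: approach_Omega_def)
        have Im: "0 < Im w" using w(1) by (auto simp: approach_Delta_def)
        have "exp (\<i> * of_real \<phi>) = 1" using True by (simp add: p_def)
        note cd = cayley_disc_map[OF this Im]
        have "dist z p = norm (1 - z)" unfolding True dist_norm by (rule norm_minus_commute)
        with z(2) have close: "norm (1 - z) < min d 1" by simp
        have "1 \<le> norm (1 + z)"
          using norm_triangle_ineq2[of 2 "1 - z"] close by simp
        moreover have "norm w = norm (1 - z) / norm (1 + z)"
          using arg_cong[OF cd(2), of norm] by (simp add: w(2) norm_mult norm_divide)
        ultimately have "norm w \<le> norm (1 - z)" by (simp add: divide_le_eq mult_le_cancel_left1)
        then have "norm w < d" using close by simp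
        then show ?thesis using d(2)[OF w(1)] cd(1) by (simp add: w(2))
      qed
      then show "\<exists>d>0. \<forall>x\<in>approach_Omega h \<phi>. x \<noteq> p \<and> dist x p < d \<longrightarrow> dist (Im (F (cayley x))) 0 < e"
        using d(1) by (intro exI[of _ "min d 1"]) auto
    qed
  qed
  then show "((\<lambda>z. Im (F (cayley z))) \<longlongrightarrow> 0) (at (exp (\<i> * of_real \<phi>)) within approach_Omega h \<phi>)"
    by (simp add: p_def)
qed

text \<open>
  If $\mathrm{Im}\,F$ vanished on the upper half-plane, $F$ would be constant there by the open mapping
  theorem; the decay along the imaginary axis forces the constant to be 0, and continuity at the
  origin gives a contradiction.
\<close>

lemma Im_cayley_nonzero:
  assumes F: "F holomorphic_on UNIV" and F0: "F 0 \<noteq> 0"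
    and decay: "\<And>y. 1 < y \<Longrightarrow> norm (F (\<i> * of_real y)) * y \<le> A"
  shows "\<exists>z\<in>unit_disc. Im (F (cayley z)) \<noteq> 0"
proof (rule ccontr)
  assume "\<not> ?thesis"
  then have Im0: "Im (F \<zeta>) = 0" if "0 < Im \<zeta>" for \<zeta>
    using cayley_surj[OF that] by metis
  let ?H = "{\<zeta>. 0 < Im \<zeta>}"
  have "F constant_on ?H"
  proof (rule ccontr)
    assume "\<not> F constant_on ?H"
    then have "open (F ` ?H)"
      by (intro open_mapping_thm[of F ?H])
         (auto intro: holomorphic_on_subset[OF F] open_halfspace_Im_gt connected_halfspace_Im_gt)
    moreover have "F \<i> \<in> F ` ?H" by auto
    ultimately obtain e where e: "0 < e" "ball (F \<i>) e \<subseteq> F ` ?H"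
      by (meson open_contains_ball)
    have "F \<i> + \<i> * of_real (e / 2) \<in> ball (F \<i>) e" using e(1) by (simp add: dist_norm norm_mult)
    then obtain \<zeta> where \<zeta>: "0 < Im \<zeta>" "F \<i> + \<i> * of_real (e / 2) = F \<zeta>" using e(2) by auto
    have "Im (F \<i>) + e / 2 = Im (F \<zeta>)" by (simp flip: \<zeta>(2))
    then show False using Im0[OF \<zeta>(1)] Im0[of \<i>] e(1) by simp
  qed
  then obtain k where k: "\<And>\<zeta>. 0 < Im \<zeta> \<Longrightarrow> F \<zeta> = k" by (auto simp: constant_on_def)
  have "k = 0"
  proof (rule ccontr)
    assume "k \<noteq> 0"
    define y where "y = max 2 ((A + 1) / norm k)"
    have "norm k * y \<le> A" using decay[of y] k[of "\<i> * of_real y"] by (simp add: y_def)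
    moreover have "A + 1 \<le> norm k * y" using \<open>k \<noteq> 0\<close> by (simp add: y_def max_def field_simps)
    ultimately show False by simp
  qed
  have "(\<lambda>n. F (\<i> * of_real (inverse (real (Suc n))))) \<longlonglongrightarrow> F (\<i> * of_real 0)"
    using holomorphic_on_imp_continuous_on[OF F]
    by (intro isCont_tendsto_compose[of _ F] tendsto_intros LIMSEQ_inverse_real_of_nat)
       (simp add: continuous_on_eq_continuous_at)
  moreover have "F (\<i> * of_real (inverse (real (Suc n)))) = 0" for n
    using k[of "\<i> * of_real (inverse (real (Suc n)))"] \<open>k = 0\<close> by simp
  ultimately have "F 0 = 0" by (simp add: LIMSEQ_const_iff)
  with F0 show False by simp
qed

lemma circle_max_le:
  assumes "\<And>z. norm z = r \<Longrightarrow> v z \<le> B" "0 < r"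
  shows "circle_max r v \<le> B"
  unfolding circle_max_def by (rule cSUP_least) (use assms in \<open>auto simp: norm_mult\<close>)

lemma log_plus_le: "s \<le> exp t \<Longrightarrow> 0 \<le> t \<Longrightarrow> log_plus s \<le> t"
proof (cases "0 < s")
  case True
  assume s: "s \<le> exp t" and t: "0 \<le> t"
  have "ln s \<le> ln (exp t)" using True s by (subst ln_le_cancel_iff) auto
  then show ?thesis using True t by (simp add: log_plus_def)
qed (simp add: log_plus_def)

text \<open>
  Division of the entire function by a large constant turns both of its bounds into bounds
  with constant 1, which is what estimates of $\log^+$ valid for every radius require.
\<close>

lemma (in line_transform) exists_harmonic:
  assumes region: "\<And>w. w \<in> approach_Delta h \<Longrightarrow> norm w < 1 \<Longrightarrow> - 1 / w \<in> D"
    and h: "\<And>t. 0 < t \<Longrightarrow> t < 1 \<Longrightarrow> 0 \<le> h t"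
  shows "\<exists>u. harmonic_on unit_disc u \<and> (\<exists>z\<in>unit_disc. u z \<noteq> 0) \<and> vanishing_approach_limits h u \<and>
    (\<forall>z\<in>unit_disc. \<forall>a\<ge>0. 2 * norm (cayley z) \<le> m a \<longrightarrow> \<bar>u z\<bar> \<le> exp (6 * \<epsilon> * a)) \<and>
    (\<forall>z\<in>unit_disc. cayley z \<in> D \<longrightarrow> 1 \<le> norm (cayley z) \<longrightarrow> \<bar>u z\<bar> \<le> 1)"
proof -
  obtain A B where A: "\<And>a \<zeta>. 0 \<le> a \<Longrightarrow> 2 * norm \<zeta> \<le> m a \<Longrightarrow> norm (transform \<zeta>) \<le> A * exp (6 * \<epsilon> * a)"
    and B: "\<And>\<zeta>. \<zeta> \<in> D \<Longrightarrow> norm (transform \<zeta>) * norm \<zeta> \<le> B"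
    using transform_growth transform_decay by blast
  define M where "M = max 1 (max A B)"
  have M: "1 \<le> M" "A \<le> M" "B \<le> M" by (auto simp: M_def)
  define F where "F \<zeta> = transform \<zeta> / of_real M" for \<zeta>
  have holF: "F holomorphic_on S" for S
    unfolding F_def using M(1) by (intro holomorphic_intros holomorphic_transform) auto
  have realF: "Im (F (of_real x)) = 0" for x
    by (simp add: F_def Im_divide_of_real transform_real)
  have growth: "norm (F \<zeta>) \<le> exp (6 * \<epsilon> * a)" if "0 \<le> a" "2 * norm \<zeta> \<le> m a" for a \<zeta>
  proof -
    have "norm (transform \<zeta>) \<le> A * exp (6 * \<epsilon> * a)" by (rule A[OF that])
    also have "\<dots> \<le> exp (6 * \<epsilon> * a) * M" using M(2) by simp
    finally show ?thesis using M(1) by (simp add: F_def norm_divide divide_le_eq)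
  qed
  have decay: "norm (F \<zeta>) * norm \<zeta> \<le> 1" if "\<zeta> \<in> D" for \<zeta>
    using B[OF that] M by (simp add: F_def norm_divide divide_le_eq)
  let ?u = "\<lambda>z. Im (F (cayley z))"
  have "(\<lambda>z. F (cayley z)) holomorphic_on unit_disc"
    by (rule holomorphic_on_compose_gen[of cayley _ F UNIV, unfolded o_def])
       (auto intro: holF holomorphic_on_subset[OF holomorphic_cayley])
  then have "harmonic_on unit_disc ?u" by (intro harmonic_on_Im) auto
  moreover have "\<exists>z\<in>unit_disc. ?u z \<noteq> 0"
  proof (rule Im_cayley_nonzero[OF holF])
    show "F 0 \<noteq> 0" using transform_0_nonzero M(1) by (simp add: F_def)
    fix y :: real assume y: "1 < y"
    \<comment> \<open>a segment of the imaginary axis that ends at 0 lies in every approach region\<close>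
    let ?w = "Complex 0 (1 / y)"
    have "?w \<in> approach_Delta h" using y h[of "1 / y"] by (auto simp: approach_Delta_def)
    moreover have "norm ?w < 1" using y by (simp add: cmod_def)
    moreover have "- 1 / ?w = \<i> * of_real y" using y by (simp add: complex_eq_iff Re_divide Im_divide power2_eq_square)
    ultimately have "\<i> * of_real y \<in> D" using region by metis
    from decay[OF this] y show "norm (F (\<i> * of_real y)) * y \<le> 1" by (simp add: norm_mult)
  qed
  moreover have "vanishing_approach_limits h ?u"
  proof (rule vanishing_approach_limits_cayley[OF holF realF])
    fix e :: real assume e: "0 < e"
    have "\<bar>Im (F (- 1 / w))\<bar> < e" if w: "w \<in> approach_Delta h" "norm w < min e 1" for w
    proof -
      have "w \<noteq> 0" using w(1) by (auto simp: approach_Delta_def complex_eq_iff)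
      have "norm (F (- 1 / w)) / norm w \<le> 1" using decay[OF region[OF w(1)]] w(2) by (simp add: norm_divide)
      then have "norm (F (- 1 / w)) \<le> norm w" using \<open>w \<noteq> 0\<close> by (simp add: divide_le_eq)
      then show ?thesis using abs_Im_le_cmod[of "F (- 1 / w)"] w(2) by linarith
    qed
    then show "\<exists>d>0. \<forall>w\<in>approach_Delta h. norm w < d \<longrightarrow> \<bar>Im (F (- 1 / w))\<bar> < e"
      using e by (intro exI[of _ "min e 1"]) auto
  qed
  moreover have "\<bar>?u z\<bar> \<le> exp (6 * \<epsilon> * a)" if "0 \<le> a" "2 * norm (cayley z) \<le> m a" for z a
    using growth[OF that] abs_Im_le_cmod order_trans by blast
  moreover have "\<bar>?u z\<bar> \<le> 1" if "cayley z \<in> D" "1 \<le> norm (cayley z)" for z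
  proof -
    have "norm (F (cayley z)) * 1 \<le> norm (F (cayley z)) * norm (cayley z)"
      using that(2) by (intro mult_left_mono) auto
    then show ?thesis using decay[OF that(1)] abs_Im_le_cmod[of "F (cayley z)"] by linarith
  qed
  ultimately show ?thesis by (intro exI[of _ ?u]) auto
qed

section \<open>The four approach regions\<close>

lemma
  assumes "0 < Re z"
  shows Re_powr_of_real: "Re (z powr of_real \<beta>) = norm z powr \<beta> * cos (\<beta> * Im (Ln z))"
    and Im_powr_of_real: "Im (z powr of_real \<beta>) = norm z powr \<beta> * sin (\<beta> * Im (Ln z))"
    and norm_powr_of_real: "norm (z powr of_real \<beta>) = norm z powr \<beta>"
    and abs_Im_Ln_less: "\<bar>Im (Ln z)\<bar> < pi / 2"
proof -
  have "z \<noteq> 0" using assms by auto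
  then show "Re (z powr of_real \<beta>) = norm z powr \<beta> * cos (\<beta> * Im (Ln z))"
    and "Im (z powr of_real \<beta>) = norm z powr \<beta> * sin (\<beta> * Im (Ln z))"
    and "norm (z powr of_real \<beta>) = norm z powr \<beta>"
    by (simp_all add: powr_def Re_exp Im_exp norm_exp_eq_Re)
  show "\<bar>Im (Ln z)\<bar> < pi / 2" using Re_Ln_pos_lt[OF \<open>z \<noteq> 0\<close>] assms by simp
qed

lemma cnj_powr_of_real:
  assumes "0 < Re z"
  shows "cnj (z powr of_real \<beta>) = cnj z powr of_real \<beta>"
proof -
  have "z \<noteq> 0" "z \<notin> \<real>\<^sub>\<le>\<^sub>0" using assms by (auto simp: complex_nonpos_Reals_iff)
  then show ?thesis by (simp add: powr_def cnj_Ln exp_cnj)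
qed

lemma shift_norm_le:
  assumes "0 \<le> a"
  shows "norm (z + of_real a :: complex) \<le> (1 + a) * (1 + norm z)"
proof -
  have "norm (z + of_real a) \<le> norm z + a" using norm_triangle_ineq[of z "of_real a"] assms by simp
  also have "\<dots> \<le> (1 + a) * (1 + norm z)" using assms by (simp add: algebra_simps)
  finally show ?thesis .
qed

lemma approach_Delta_image:
  assumes "w \<in> approach_Delta h"
  obtains x y where "w = Complex x y" "\<bar>x\<bar> \<le> h y" "0 < y" "y < 1" "0 < (norm w)\<^sup>2"
    "Re (- 1 / w) = - x / (norm w)\<^sup>2" "Im (- 1 / w) = y / (norm w)\<^sup>2" "y\<^sup>2 \<le> (norm w)\<^sup>2"
proof -
  obtain x y where xy: "w = Complex x y" "\<bar>x\<bar> \<le> h y" "0 < y" "y < 1"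
    using assms by (auto simp: approach_Delta_def)
  then have "w \<noteq> 0" by (auto simp: complex_eq_iff)
  have "- 1 / w = - cnj w / of_real ((norm w)\<^sup>2)"
    by (subst complex_div_cnj) simp
  then have "Re (- 1 / w) = - x / (norm w)\<^sup>2" "Im (- 1 / w) = y / (norm w)\<^sup>2"
    by (simp_all only: Re_divide_of_real Im_divide_of_real) (simp_all add: xy(1))
  moreover have "y\<^sup>2 \<le> (norm w)\<^sup>2" by (simp add: xy(1) cmod_power2)
  ultimately show ?thesis using that xy \<open>w \<noteq> 0\<close> by simp
qed

lemma log_plus_circle_max_le:
  assumes "\<And>z. norm z = r \<Longrightarrow> \<bar>u z\<bar> \<le> exp t" "0 \<le> t" "0 < r"
  shows "log_plus (circle_max r (\<lambda>z. \<bar>u z\<bar>)) \<le> t"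
  by (rule log_plus_le[OF circle_max_le]) (use assms in auto)

text \<open>
  For $F(\zeta) = \zeta^2$ the function is $\mathrm{Im}\,w^{-2} = -2xy/|w|^4$, and $|w|^4 \ge y^4$, so
  $x = o(y^3)$ makes it tend to 0.
\<close>

lemma cubic_tangency:
  assumes h: "h \<in> o[at_right 0](\<lambda>t. t ^ 3)"
  shows "\<exists>u. harmonic_on unit_disc u \<and> (\<exists>z\<in>unit_disc. u z \<noteq> 0) \<and> vanishing_approach_limits h u \<and>
    (\<lambda>r. circle_max r (\<lambda>z. \<bar>u z\<bar>)) \<in> O[at_left 1](\<lambda>r. 1 / (1 - r) ^ 2)"
proof -
  let ?F = "\<lambda>\<zeta>::complex. \<zeta>\<^sup>2"
  let ?u = "\<lambda>z. Im (?F (cayley z))"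
  have hol: "(\<lambda>z. ?F (cayley z)) holomorphic_on unit_disc"
    by (intro holomorphic_intros holomorphic_on_subset[OF holomorphic_cayley]) auto
  have "harmonic_on unit_disc ?u" by (rule harmonic_on_Im[OF hol]) simp
  moreover have "\<exists>z\<in>unit_disc. ?u z \<noteq> 0"
  proof -
    obtain z where "z \<in> unit_disc" "cayley z = 1 + \<i>" using cayley_surj[of "1 + \<i>"] by auto
    then show ?thesis by (intro bexI[of _ z]) (simp_all add: power2_eq_square)
  qed
  moreover have "vanishing_approach_limits h ?u"
  proof (rule vanishing_approach_limits_cayley)
    fix e :: real assume e: "0 < e"
    then have "0 < e / 4" by simp
    from landau_o.smallD[OF h this] obtain d where d: "0 < d" "\<And>t. 0 < t \<Longrightarrow> t < d \<Longrightarrow> \<bar>h t\<bar> \<le> e / 4 * t ^ 3"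
      by (auto simp: eventually_at_right_field power_abs)
    have "\<bar>Im (?F (- 1 / w))\<bar> < e" if w: "w \<in> approach_Delta h" "norm w < d" for w
    proof -
      from w(1) obtain x y where xy: "w = Complex x y" "\<bar>x\<bar> \<le> h y" "0 < y" "y < 1" "0 < (norm w)\<^sup>2"
        "Re (- 1 / w) = - x / (norm w)\<^sup>2" "Im (- 1 / w) = y / (norm w)\<^sup>2" "y\<^sup>2 \<le> (norm w)\<^sup>2"
        by (rule approach_Delta_image)
      have "y < d" using w(2) abs_Im_le_cmod[of w] xy by simp
      then have "\<bar>x\<bar> \<le> e / 4 * y ^ 3" using d(2)[of y] xy(2,3) by simp
      then have "\<bar>x\<bar> * y \<le> e / 4 * y ^ 3 * y" using xy(3) by (intro mult_right_mono) auto
      also have "\<dots> = e / 4 * (y\<^sup>2)\<^sup>2" by (simp add: power2_eq_square power3_eq_cube)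
      also have "\<dots> \<le> e / 4 * ((norm w)\<^sup>2)\<^sup>2"
        using e by (intro mult_left_mono power_mono[OF xy(8)]) auto
      finally have b: "\<bar>x\<bar> * y \<le> e / 4 * ((norm w)\<^sup>2)\<^sup>2" .
      have "Im (?F (- 1 / w)) = 2 * (- x / (norm w)\<^sup>2) * (y / (norm w)\<^sup>2)"
        unfolding Im_power2 xy(6,7) ..
      then have "\<bar>Im (?F (- 1 / w))\<bar> = 2 * (\<bar>x\<bar> * y) / ((norm w)\<^sup>2)\<^sup>2"
        using xy(3) by (simp add: abs_mult power2_eq_square)
      also have "\<dots> \<le> e / 2" using b xy(5) by (simp add: divide_le_eq)
      finally show ?thesis using e by simp
    qed
    then show "\<exists>d>0. \<forall>w\<in>approach_Delta h. norm w < d \<longrightarrow> \<bar>Im (?F (- 1 / w))\<bar> < e"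
      using d(1) by blast
  qed (auto intro!: holomorphic_intros simp: Im_power2)
  moreover have "(\<lambda>r. circle_max r (\<lambda>z. \<bar>?u z\<bar>)) \<in> O[at_left 1](\<lambda>r. 1 / (1 - r) ^ 2)"
  proof (rule bigoI)
    have "eventually (\<lambda>r::real. r \<in> {0<..<1}) (at_left 1)" by (rule eventually_at_left_real) simp
    then show "eventually (\<lambda>r. norm (circle_max r (\<lambda>z. \<bar>?u z\<bar>)) \<le> 4 * norm (1 / (1 - r) ^ 2)) (at_left 1)"
    proof eventually_elim
      case (elim r)
      then have r: "0 < r" "r < 1" by auto
      have "\<bar>?u z\<bar> \<le> 4 / (1 - r)\<^sup>2" if "norm z = r" for z
      proof -
        have "\<bar>?u z\<bar> \<le> norm (cayley z) ^ 2" using abs_Im_le_cmod[of "?F (cayley z)"] by (simp add: norm_power)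
        also have "\<dots> \<le> (2 / (1 - r))\<^sup>2" using norm_cayley_le[of z] that r by (intro power_mono) auto
        finally show ?thesis by (simp add: power_divide)
      qed
      then have "circle_max r (\<lambda>z. \<bar>?u z\<bar>) \<le> 4 / (1 - r)\<^sup>2" by (rule circle_max_le[OF _ r(1)])
      moreover have "continuous_on unit_disc (\<lambda>z. \<bar>?u z\<bar>)"
        by (rule continuous_on_rabs[OF continuous_on_Im[OF holomorphic_on_imp_continuous_on[OF hol]]])
      then have "0 \<le> circle_max r (\<lambda>z. \<bar>?u z\<bar>)"
        using circle_max_attained[OF _ r, of "\<lambda>z. \<bar>?u z\<bar>"] by auto
      ultimately show ?case using r by simp
    qed
  qed
  ultimately show ?thesis by (intro exI[of _ ?u]) auto
qed

lemma vanishing_approach_limits_mono: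
  assumes "vanishing_approach_limits h u" "\<And>t. 0 < t \<Longrightarrow> t < 1 \<Longrightarrow> g t \<le> h t"
  shows "vanishing_approach_limits g u"
proof -
  have "approach_Omega g \<phi> \<subseteq> approach_Omega h \<phi>" for \<phi>
    unfolding approach_Omega_def approach_Delta_def using assms(2) by (force intro!: image_mono)
  then show ?thesis
    using assms(1) unfolding vanishing_approach_limits_def by (meson tendsto_within_subset)
qed

text \<open>
  For $1 < \gamma < 2$ the image of the approach region under $w \mapsto -1/w$ lies in
  $\xi \le \eta^{2-\gamma}$. The imaginary axis is mapped by $Z \mapsto Z + Z^\beta$ to a curve
  $\xi \approx \mathrm{const}\cdot\eta^\beta$, which for $2 - \gamma < \beta < 1$ runs to the right of that set. The term
  $Z$ alone makes $|T|$ at least as large as $\mathrm{Re}\,Z$, so that the entire function has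
  exponential type. The translation by \<open>a0\<close> discards the part near the origin, where the comparison of
  powers is not yet valid.
\<close>

lemma tangential_line_transform:
  fixes \<beta> \<beta>0 :: real
  assumes "0 < \<beta>0" "\<beta>0 < \<beta>" "\<beta> < 1" "0 < \<epsilon>"
  shows "\<exists>a0\<ge>1. line_transform (\<lambda>z. (z + of_real a0) + (z + of_real a0) powr of_real \<beta>) (\<lambda>x. x + a0)
           (2 * (1 + a0)) 1 \<epsilon> {\<zeta>. 0 < Im \<zeta> \<and> Re \<zeta> \<le> Im \<zeta> powr \<beta>0}"
proof -
  \<comment> \<open>a lower bound for $\cos(\beta\arg Z)$ on the right half-plane\<close>
  define k where "k = cos (\<beta> * (pi / 2))"
  have \<beta>pi: "\<beta> * (pi / 2) < pi / 2" using assms by simp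
  have k: "0 < k" unfolding k_def using assms \<beta>pi by (intro cos_gt_zero) auto
  have "eventually (\<lambda>x::real. (3 * x) powr \<beta>0 < k * x powr \<beta>) at_top"
    using assms k by real_asymp
  then obtain x0 where x0: "\<And>x. x0 \<le> x \<Longrightarrow> (3 * x) powr \<beta>0 < k * x powr \<beta>"
    by (auto simp: eventually_at_top_linorder)
  define a0 where "a0 = max 1 x0"
  let ?Z = "\<lambda>z::complex. z + of_real a0"
  let ?T = "\<lambda>z. ?Z z + ?Z z powr of_real \<beta>"
  have a0: "1 \<le> a0" "x0 \<le> a0" by (auto simp: a0_def)
  have RZ: "a0 \<le> Re (?Z z)" "0 < Re (?Z z)" "a0 \<le> norm (?Z z)" if "0 \<le> Re z" for z
    using that a0 complex_Re_le_cmod[of "?Z z"] by auto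
  have normT: "norm (?T z) \<le> 2 * norm (?Z z)" if "0 \<le> Re z" for z
  proof -
    have "norm (?Z z) powr \<beta> \<le> norm (?Z z) powr 1"
      using RZ[OF that] a0 assms by (intro powr_mono) auto
    then have "norm (?Z z powr of_real \<beta>) \<le> norm (?Z z)"
      using norm_powr_of_real[OF RZ(2)[OF that], of \<beta>] RZ[OF that] a0 by simp
    then show ?thesis using norm_triangle_ineq[of "?Z z" "?Z z powr of_real \<beta>"] by linarith
  qed
  have ReT: "Re (?Z z) + k * norm (?Z z) powr \<beta> \<le> Re (?T z)" if "0 \<le> Re z" for z
  proof -
    have "\<bar>\<beta> * Im (Ln (?Z z))\<bar> \<le> \<beta> * (pi / 2)"
      using abs_Im_Ln_less[OF RZ(2)[OF that]] assms by (simp add: abs_mult)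
    then have "cos (\<beta> * (pi / 2)) \<le> cos \<bar>\<beta> * Im (Ln (?Z z))\<bar>"
      using \<beta>pi by (intro cos_monotone_0_pi_le) auto
    then have "k \<le> cos (\<beta> * Im (Ln (?Z z)))" by (simp add: k_def)
    then have "norm (?Z z) powr \<beta> * k \<le> norm (?Z z) powr \<beta> * cos (\<beta> * Im (Ln (?Z z)))"
      by (rule mult_left_mono) simp
    then show ?thesis using Re_powr_of_real[OF RZ(2)[OF that], of \<beta>] by (simp add: mult.commute)
  qed
  have "line_transform ?T (\<lambda>x. x + a0) (2 * (1 + a0)) 1 \<epsilon> {\<zeta>. 0 < Im \<zeta> \<and> Re \<zeta> \<le> Im \<zeta> powr \<beta>0}"
  proof
    have "?Z z \<notin> \<real>\<^sub>\<le>\<^sub>0" if "0 \<le> Re z" for z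
      using RZ(2)[OF that] by (auto simp: complex_nonpos_Reals_iff)
    then show "?T holomorphic_on half_plane" by (intro holomorphic_intros) auto
    show "filterlim (\<lambda>x. x + a0) at_top at_top" by real_asymp
    fix z :: complex assume z: "0 \<le> Re z"
    show "norm (?T z) \<le> 2 * (1 + a0) * (1 + norm z)"
    proof -
      have "norm (?Z z) \<le> (1 + a0) * (1 + norm z)" using a0 by (intro shift_norm_le) simp
      with normT[OF z] show ?thesis unfolding mult.assoc by linarith
    qed
    have "0 \<le> k * norm (?Z z) powr \<beta>" using k by simp
    then show "Re z + a0 \<le> norm (?T z)"
      using ReT[OF z] complex_Re_le_cmod[of "?T z"] by simp
    show "?T (cnj z) = cnj (?T z)"
      using cnj_powr_of_real[OF RZ(2)[OF z], of \<beta>] by simp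
    fix \<zeta> assume "\<zeta> \<in> {\<zeta>. 0 < Im \<zeta> \<and> Re \<zeta> \<le> Im \<zeta> powr \<beta>0}"
    then have \<zeta>: "0 < Im \<zeta>" "Re \<zeta> \<le> Im \<zeta> powr \<beta>0" by auto
    have "1 \<le> norm (?T z - \<zeta>)"
    proof (rule ccontr)
      assume "\<not> ?thesis"
      then have near: "\<bar>Re (?T z) - Re \<zeta>\<bar> < 1" "\<bar>Im (?T z) - Im \<zeta>\<bar> < 1"
        using abs_Re_le_cmod[of "?T z - \<zeta>"] abs_Im_le_cmod[of "?T z - \<zeta>"] by auto
      have "Im \<zeta> \<le> 3 * norm (?Z z)"
        using near(2) normT[OF z] abs_Im_le_cmod[of "?T z"] RZ(3)[OF z] a0 by linarith
      then have "Re \<zeta> \<le> (3 * norm (?Z z)) powr \<beta>0"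
        using \<zeta> assms by (meson order_trans powr_mono2 less_imp_le)
      also have "\<dots> < k * norm (?Z z) powr \<beta>" using x0 RZ(3)[OF z] a0 by simp
      also have "\<dots> \<le> Re (?T z) - 1" using ReT[OF z] RZ(1)[OF z] a0 by linarith
      finally show False using near(1) by linarith
    qed
    then have "1 * 1 \<le> norm (?T z - \<zeta>) * (1 + norm z)" by (intro mult_mono) auto
    then show "1 \<le> norm (?T z - \<zeta>) * (1 + norm z)" by simp
  qed (use a0 assms in \<open>auto intro!: mono_onI\<close>)
  then show ?thesis using a0 by blast
qed

lemma tangential_region:
  assumes "1 < \<gamma>" and w: "w \<in> approach_Delta (\<lambda>t. t powr \<gamma>)"
  shows "0 < Im (- 1 / w) \<and> Re (- 1 / w) \<le> Im (- 1 / w) powr (2 - \<gamma>)"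
proof -
  from w obtain x y where xy: "w = Complex x y" "\<bar>x\<bar> \<le> y powr \<gamma>" "0 < y" "y < 1" "0 < (norm w)\<^sup>2"
    "Re (- 1 / w) = - x / (norm w)\<^sup>2" "Im (- 1 / w) = y / (norm w)\<^sup>2" "y\<^sup>2 \<le> (norm w)\<^sup>2"
    by (rule approach_Delta_image)
  define R where "R = (norm w)\<^sup>2"
  have R: "0 < R" "y\<^sup>2 \<le> R" using xy by (auto simp: R_def)
  have "y powr (2 * (\<gamma> - 1)) = (y\<^sup>2) powr (\<gamma> - 1)"
    using powr_powr[of y 2 "\<gamma> - 1"] xy(3) by simp
  also have "\<dots> \<le> R powr (\<gamma> - 1)" using R assms by (intro powr_mono2) auto
  finally have key: "y powr (2 * (\<gamma> - 1)) \<le> R powr (\<gamma> - 1)" .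
  have "- x / R \<le> y powr \<gamma> / R" using xy(2) R by (intro divide_right_mono) auto
  also have "y powr \<gamma> = y powr (2 - \<gamma>) * y powr (2 * (\<gamma> - 1))" by (simp flip: powr_add)
  also have "\<dots> / R \<le> y powr (2 - \<gamma>) * R powr (\<gamma> - 1) / R"
    using key R by (intro divide_right_mono mult_left_mono) auto
  also have "y powr (2 - \<gamma>) * R powr (\<gamma> - 1) / R = y powr (2 - \<gamma>) * (R powr (\<gamma> - 1) / R)" by simp
  also have "R powr (\<gamma> - 1) / R = 1 / R powr (2 - \<gamma>)"
    using R powr_diff[of R "\<gamma> - 1" 1] powr_minus_divide[of R "2 - \<gamma>"] by simp
  finally have "- x / R \<le> (y / R) powr (2 - \<gamma>)"
    using xy(3) R by (simp add: powr_divide)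
  then show ?thesis using xy R by (simp add: R_def)
qed

lemma tangential_case:
  assumes "1 < \<gamma>" "0 < \<epsilon>"
  shows "\<exists>u. harmonic_on unit_disc u \<and> (\<exists>z\<in>unit_disc. u z \<noteq> 0) \<and>
    vanishing_approach_limits (\<lambda>t. t powr \<gamma>) u \<and>
    (\<forall>r. 0 < r \<and> r < 1 \<longrightarrow> log_plus (circle_max r (\<lambda>z. \<bar>u z\<bar>)) \<le> \<epsilon> * (1 / (1 - r)))"
proof -
  \<comment> \<open>the condition for a smaller exponent is stronger, so an exponent below 2 can be assumed\<close>
  define g where "g = min \<gamma> (3 / 2)"
  have g: "1 < g" "g < 2" "g \<le> \<gamma>" using assms by (auto simp: g_def)
  obtain a0 where a0: "1 \<le> a0" and lt: "line_transform (\<lambda>z. (z + of_real a0) + (z + of_real a0) powr of_real ((3 - g) / 2))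
      (\<lambda>x. x + a0) (2 * (1 + a0)) 1 (\<epsilon> / 24) {\<zeta>. 0 < Im \<zeta> \<and> Re \<zeta> \<le> Im \<zeta> powr (2 - g)}"
    using tangential_line_transform[of "2 - g" "(3 - g) / 2" "\<epsilon> / 24"] g assms(2) by auto
  from line_transform.exists_harmonic[OF lt, of "\<lambda>t. t powr g"] tangential_region[OF g(1)]
  obtain u where u: "harmonic_on unit_disc u" "\<exists>z\<in>unit_disc. u z \<noteq> 0"
      "vanishing_approach_limits (\<lambda>t. t powr g) u"
    and "\<forall>z\<in>unit_disc. \<forall>a\<ge>0. 2 * norm (cayley z) \<le> a + a0 \<longrightarrow> \<bar>u z\<bar> \<le> exp (6 * (\<epsilon> / 24) * a)"
    by auto
  then have growth: "\<And>z a. z \<in> unit_disc \<Longrightarrow> 0 \<le> a \<Longrightarrow> 2 * norm (cayley z) \<le> a + a0 \<Longrightarrow> \<bar>u z\<bar> \<le> exp (6 * (\<epsilon> / 24) * a)"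
    by blast
  have "vanishing_approach_limits (\<lambda>t. t powr \<gamma>) u"
    by (rule vanishing_approach_limits_mono[OF u(3)]) (use g in \<open>auto intro: powr_mono'\<close>)
  moreover have "log_plus (circle_max r (\<lambda>z. \<bar>u z\<bar>)) \<le> \<epsilon> * (1 / (1 - r))" if r: "0 < r" "r < 1" for r
  proof (rule log_plus_circle_max_le)
    fix z :: complex assume z: "norm z = r"
    have "\<bar>u z\<bar> \<le> exp (6 * (\<epsilon> / 24) * (2 * norm (cayley z)))"
      using growth[of z "2 * norm (cayley z)"] z r a0 by simp
    also have "6 * (\<epsilon> / 24) * (2 * norm (cayley z)) \<le> 6 * (\<epsilon> / 24) * (2 * (2 / (1 - r)))"
      using norm_cayley_le[of z] z r assms by (intro mult_left_mono) auto
    finally show "\<bar>u z\<bar> \<le> exp (\<epsilon> * (1 / (1 - r)))" by simp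
  qed (use r assms in auto)
  ultimately show ?thesis using u by blast
qed

text \<open>
  The power $Z \mapsto Z^\kappa$ maps the half-plane onto the sector $|\arg| < \delta$; adding 1 moves this sector
  into itself, to the distance $\sin\delta$ from the ray $\arg = \delta$. The distance is read off from
  $\mathrm{Im}(v e^{-i\delta})$, a linear functional which is nonnegative on \<open>D\<close> and at most $-\sin\delta$ on the image.
\<close>

lemma sector_line_transform:
  fixes \<delta> \<kappa> \<epsilon> :: real
  assumes \<delta>: "0 < \<delta>" "\<delta> < pi / 2" and \<kappa>_def: "\<kappa> = 2 * \<delta> / pi" and "0 < \<epsilon>"
  shows "line_transform (\<lambda>z. 1 + (z + 1) powr of_real \<kappa>) (\<lambda>x. (x + 1) powr \<kappa>)
           3 (sin \<delta>) \<epsilon> {\<zeta>. Re \<zeta> * sin \<delta> \<le> Im \<zeta> * cos \<delta>}"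
proof
  let ?Z = "\<lambda>z::complex. z + 1"
  let ?T = "\<lambda>z. 1 + ?Z z powr of_real \<kappa>"
  have \<kappa>: "0 < \<kappa>" "\<kappa> \<le> 1" using \<delta> by (auto simp: \<kappa>_def)
  have RZ: "0 < Re (?Z z)" "Re z + 1 \<le> norm (?Z z)" "1 \<le> norm (?Z z)" if "0 \<le> Re z" for z
    using that complex_Re_le_cmod[of "?Z z"] by auto
  have angle: "\<bar>\<kappa> * Im (Ln (?Z z))\<bar> < \<delta>" if "0 \<le> Re z" for z
  proof -
    have "\<kappa> * \<bar>Im (Ln (?Z z))\<bar> < \<kappa> * (pi / 2)"
      by (rule mult_strict_left_mono[OF abs_Im_Ln_less[OF RZ(1)[OF that]] \<kappa>(1)])
    also have "\<kappa> * (pi / 2) = \<delta>" by (simp add: \<kappa>_def)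
    finally show ?thesis using \<kappa>(1) by (simp add: abs_mult)
  qed
  have "?Z z \<notin> \<real>\<^sub>\<le>\<^sub>0" if "0 \<le> Re z" for z
    using RZ(1)[OF that] by (auto simp: complex_nonpos_Reals_iff)
  then show "?T holomorphic_on half_plane" by (intro holomorphic_intros) auto
  show "filterlim (\<lambda>x. (x + 1) powr \<kappa>) at_top at_top" using \<kappa>(1) by real_asymp
  show "0 < sin \<delta>" using \<delta> by (intro sin_gt_zero) auto
  show "mono_on {0..} (\<lambda>x. (x + 1) powr \<kappa>)" using \<kappa>(1) by (intro mono_onI powr_mono2) auto
  fix z :: complex assume z: "0 \<le> Re z"
  show "norm (?T z) \<le> 3 * (1 + norm z)"
  proof -
    have "norm (?Z z) powr \<kappa> \<le> norm (?Z z) powr 1"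
      using RZ(3)[OF z] \<kappa> by (intro powr_mono) auto
    then have "norm (?Z z powr of_real \<kappa>) \<le> norm (?Z z)"
      using norm_powr_of_real[OF RZ(1)[OF z], of \<kappa>] by simp
    then show ?thesis
      using norm_triangle_ineq[of 1 "?Z z powr of_real \<kappa>"] norm_triangle_ineq[of z 1] norm_ge_zero[of z]
      unfolding norm_one distrib_left by linarith
  qed
  have Re0: "0 \<le> Re (?Z z powr of_real \<kappa>)"
  proof -
    have "0 \<le> cos (\<kappa> * Im (Ln (?Z z)))"
      using angle[OF z] \<delta> by (intro cos_ge_zero) auto
    then show ?thesis unfolding Re_powr_of_real[OF RZ(1)[OF z]] by simp
  qed
  show "(Re z + 1) powr \<kappa> \<le> norm (?T z)"
  proof -
    have "(Re z + 1) powr \<kappa> \<le> norm (?Z z) powr \<kappa>"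
      using z RZ(2)[OF z] \<kappa> by (intro powr_mono2) auto
    also have "\<dots> = norm (?Z z powr of_real \<kappa>)" by (rule norm_powr_of_real[OF RZ(1)[OF z], symmetric])
    also have "\<dots> \<le> norm (?T z)"
      using power_mono[OF _ Re0, of "1 + Re (?Z z powr of_real \<kappa>)" 2] by (simp add: cmod_def)
    finally show ?thesis .
  qed
  show "?T (cnj z) = cnj (?T z)"
    using cnj_powr_of_real[OF RZ(1)[OF z], of \<kappa>] by simp
  fix \<zeta> assume "\<zeta> \<in> {\<zeta>. Re \<zeta> * sin \<delta> \<le> Im \<zeta> * cos \<delta>}"
  then have \<zeta>: "Re \<zeta> * sin \<delta> \<le> Im \<zeta> * cos \<delta>" by simp
  \<comment> \<open>the argument of $Z^\kappa$\<close>
  define \<theta> where "\<theta> = \<kappa> * Im (Ln (?Z z))"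
  have Im_rot: "Im (v * exp (- (\<i> * of_real \<delta>))) = Im v * cos \<delta> - Re v * sin \<delta>" for v
    by (simp add: Re_exp Im_exp)
  have "sin (\<theta> - \<delta>) \<le> 0"
  proof -
    have "0 \<le> sin (\<delta> - \<theta>)" using angle[OF z] \<delta> unfolding \<theta>_def[symmetric] by (intro sin_ge_zero) auto
    then show ?thesis using sin_minus[of "\<delta> - \<theta>"] by simp
  qed
  then have "norm (?Z z) powr \<kappa> * (sin \<theta> * cos \<delta> - cos \<theta> * sin \<delta>) \<le> 0"
    unfolding sin_diff by (intro mult_nonneg_nonpos) auto
  then have "Im (?T z * exp (- (\<i> * of_real \<delta>))) \<le> - sin \<delta>"
    unfolding Im_rot using Re_powr_of_real[OF RZ(1)[OF z], of \<kappa>] Im_powr_of_real[OF RZ(1)[OF z], of \<kappa>]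
    by (simp add: \<theta>_def algebra_simps)
  moreover have "0 \<le> Im (\<zeta> * exp (- (\<i> * of_real \<delta>)))" unfolding Im_rot using \<zeta> by simp
  ultimately have "sin \<delta> \<le> - Im ((?T z - \<zeta>) * exp (- (\<i> * of_real \<delta>)))"
    unfolding left_diff_distrib minus_complex.sel by linarith
  also have "\<dots> \<le> norm ((?T z - \<zeta>) * exp (- (\<i> * of_real \<delta>)))"
    using abs_Im_le_cmod[of "(?T z - \<zeta>) * exp (- (\<i> * of_real \<delta>))"] by linarith
  also have "\<dots> = norm (?T z - \<zeta>)" by (simp add: norm_mult norm_exp_eq_Re)
  also have "\<dots> \<le> norm (?T z - \<zeta>) * (1 + norm z)" by (simp add: mult_le_cancel_left1)
  finally show "sin \<delta> \<le> norm (?T z - \<zeta>) * (1 + norm z)" .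
qed (use assms in auto)

text \<open>
  With $\tan\delta = 1/c$, the map $w \mapsto -1/w$ sends $|x| \le c y$ to points to the left of the ray
  $\arg = \delta$. The image of the line $\mathrm{Re}\,z = a$ recedes like $a^{2\delta/\pi}$, which gives the order
  $\pi/(2\delta)$.
\<close>

lemma sector_case:
  fixes c \<epsilon> :: real
  assumes c: "0 < c" and \<epsilon>: "0 < \<epsilon>"
  shows "\<exists>u. harmonic_on unit_disc u \<and> (\<exists>z\<in>unit_disc. u z \<noteq> 0) \<and>
    vanishing_approach_limits (\<lambda>t. c * t) u \<and>
    (\<forall>r. 0 < r \<and> r < 1 \<longrightarrow> log_plus (circle_max r (\<lambda>z. \<bar>u z\<bar>))
        \<le> \<epsilon> * (1 - r) powr (- (pi / (2 * arctan (1 / c)))))"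
proof -
  define \<delta> where "\<delta> = arctan (1 / c)"
  have \<delta>: "0 < \<delta>" "\<delta> < pi / 2" using c arctan_ubound by (auto simp: \<delta>_def)
  define \<rho> where "\<rho> = pi / (2 * \<delta>)"
  have \<rho>: "0 < \<rho>" "2 * \<delta> / pi = 1 / \<rho>" using \<delta> by (auto simp: \<rho>_def)
  \<comment> \<open>compensates the factor 6 from the weight and the factor 4 in $2|\zeta| \le 4/(1-r)$\<close>
  define e where "e = \<epsilon> / (6 * 4 powr \<rho>)"
  have e: "0 < e" using \<epsilon> by (simp add: e_def)
  note lt = sector_line_transform[OF \<delta> refl e]
  have cos: "0 < cos \<delta>" using \<delta> by (intro cos_gt_zero) auto
  have sin: "c * sin \<delta> = cos \<delta>"
    using tan_arctan[of "1 / c"] cos c by (simp add: \<delta>_def[symmetric] tan_def field_simps)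
  have region: "- 1 / w \<in> {\<zeta>. Re \<zeta> * sin \<delta> \<le> Im \<zeta> * cos \<delta>}" if "w \<in> approach_Delta (\<lambda>t. c * t)" for w
  proof -
    from that obtain x y where xy: "w = Complex x y" "\<bar>x\<bar> \<le> c * y" "0 < y" "y < 1" "0 < (norm w)\<^sup>2"
      "Re (- 1 / w) = - x / (norm w)\<^sup>2" "Im (- 1 / w) = y / (norm w)\<^sup>2" "y\<^sup>2 \<le> (norm w)\<^sup>2"
      by (rule approach_Delta_image)
    have "0 < sin \<delta>" using \<delta> by (intro sin_gt_zero) auto
    then have "- x * sin \<delta> \<le> c * y * sin \<delta>" using xy(2) by (intro mult_right_mono) auto
    also have "\<dots> = y * cos \<delta>" by (simp flip: sin)
    finally have "- x * sin \<delta> / (norm w)\<^sup>2 \<le> y * cos \<delta> / (norm w)\<^sup>2"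
      by (rule divide_right_mono) simp
    then show ?thesis unfolding mem_Collect_eq xy(6,7) by simp
  qed
  from line_transform.exists_harmonic[OF lt, of "\<lambda>t. c * t"] region c
  obtain u where u: "harmonic_on unit_disc u" "\<exists>z\<in>unit_disc. u z \<noteq> 0"
      "vanishing_approach_limits (\<lambda>t. c * t) u"
    and "\<forall>z\<in>unit_disc. \<forall>a\<ge>0. 2 * norm (cayley z) \<le> (a + 1) powr (2 * \<delta> / pi) \<longrightarrow> \<bar>u z\<bar> \<le> exp (6 * e * a)"
    by auto
  then have growth: "\<And>z a. z \<in> unit_disc \<Longrightarrow> 0 \<le> a \<Longrightarrow> 2 * norm (cayley z) \<le> (a + 1) powr (2 * \<delta> / pi) \<Longrightarrow> \<bar>u z\<bar> \<le> exp (6 * e * a)"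
    by blast
  have "log_plus (circle_max r (\<lambda>z. \<bar>u z\<bar>)) \<le> \<epsilon> * (1 - r) powr (- \<rho>)" if r: "0 < r" "r < 1" for r
  proof (rule log_plus_circle_max_le)
    fix z :: complex assume z: "norm z = r"
    let ?a = "(2 * norm (cayley z)) powr \<rho>"
    have "2 * norm (cayley z) = ?a powr (2 * \<delta> / pi)"
      using \<rho> by (simp add: powr_powr)
    also have "\<dots> \<le> (?a + 1) powr (2 * \<delta> / pi)"
      using \<delta> by (intro powr_mono2) auto
    finally have "\<bar>u z\<bar> \<le> exp (6 * e * ?a)"
      using growth[of z ?a] z r by simp
    also have "?a \<le> (4 / (1 - r)) powr \<rho>"
      using norm_cayley_le[of z] z r \<rho> by (intro powr_mono2) auto
    also have "(4 / (1 - r)) powr \<rho> = 4 powr \<rho> * (1 - r) powr (- \<rho>)"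
      using r by (simp add: powr_divide powr_minus_divide)
    also have "6 * e * \<dots> = \<epsilon> * (1 - r) powr (- \<rho>)"
      by (simp add: e_def)
    finally show "\<bar>u z\<bar> \<le> exp (\<epsilon> * (1 - r) powr (- \<rho>))" using e by simp
  qed (use r \<epsilon> in auto)
  then show ?thesis using u unfolding \<rho>_def \<delta>_def by blast
qed

lemma powr_comparable:
  fixes x y s :: real
  assumes "0 < x" "x / 2 \<le> y" "y \<le> 2 * x"
  shows "2 powr (- \<bar>s\<bar>) * x powr s \<le> y powr s"
proof (cases "0 \<le> s")
  case True
  have "2 powr (- \<bar>s\<bar>) * x powr s = (x / 2) powr s"
    using True assms by (simp add: powr_divide powr_minus_divide)
  also have "\<dots> \<le> y powr s" using True assms by (intro powr_mono2) auto
  finally show ?thesis .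
next
  case False
  have "2 powr (- \<bar>s\<bar>) * x powr s = (2 * x) powr s"
    using False assms by (simp add: powr_mult)
  also have "\<dots> \<le> y powr s" using False assms by (intro powr_mono2') auto
  finally show ?thesis .
qed

lemma abs_Im_Ln_le:
  assumes "0 < Re z"
  shows "\<bar>Im (Ln z)\<bar> \<le> \<bar>Im z\<bar> / Re z"
proof -
  have "z \<noteq> 0" using assms by auto
  then have "Im (Ln z) = arctan (Im z / Re z)" using assms by (simp add: Im_Ln_eq)
  then show ?thesis using abs_arctan_le[of "Im z / Re z"] assms by simp
qed

text \<open>
  As $|Z|$ grows, $\mathrm{Ln}\,Z$ stays in a strip of half-width $\pi/2$ and runs to infinity. The power \<open>p\<close> turns
  this strip into a domain around the positive axis of half-width about $|\zeta|^{1-1/p}$, and the factor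
  \<open>\<kappa>\<close> makes the implied constant as small as required by \<open>b\<close>. The image of the line $\mathrm{Re}\,z = a$ recedes
  only like $(\log a)^p$, which is the origin of the double exponential growth.
\<close>

lemma cusp_line_transform:
  fixes p b \<epsilon> :: real
  assumes p: "0 < p" and b: "0 < b" and \<epsilon>: "0 < \<epsilon>"
  shows "\<exists>\<kappa> a0 C c. 0 < \<kappa> \<and> 1 \<le> a0 \<and>
    line_transform (\<lambda>z. of_real \<kappa> * Ln (z + of_real a0) powr of_real p) (\<lambda>x. \<kappa> * ln (x + a0) powr p)
      C c \<epsilon> {\<zeta>. Re \<zeta> \<le> 0 \<or> b * norm \<zeta> powr (1 - 1 / p) \<le> Im \<zeta>}"
proof -
  define q where "q = 1 / p"
  have q: "0 < q" "p * q = 1" "q * p = 1" using p by (auto simp: q_def)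
  \<comment> \<open>the bound on \<open>D\<close> survives with \<open>b'\<close> when $|\zeta|$ is replaced by a quantity within a factor 2 of it\<close>
  define b' where "b' = b * 2 powr (- \<bar>1 - q\<bar>)"
  have b': "0 < b'" using b by (simp add: b'_def)
  \<comment> \<open>chosen such that the image of \<open>T\<close> has at most half of the half-width that \<open>D\<close> leaves free\<close>
  define \<kappa> where "\<kappa> = (b' / (2 * p * pi)) powr p"
  have \<kappa>: "0 < \<kappa>" using b' p by (simp add: \<kappa>_def)
  have \<kappa>q: "\<kappa> powr q = b' / (2 * p * pi)" using b' p q by (simp add: \<kappa>_def powr_powr)
  \<comment> \<open>for $|Z|$ at least \<open>a0\<close>, $\mathrm{Ln}\,Z$ has a small argument, $|T| \ge 2$, and $|T|$ is at most linear in $|Z|$\<close>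
  have "eventually (\<lambda>x::real. 1 \<le> x \<and> pi / 2 \<le> ln x \<and> p * pi / 2 \<le> ln x \<and> 2 \<le> \<kappa> * ln x powr p
          \<and> (2 * ln x) powr p \<le> x \<and> 2 * ln x \<le> x) at_top"
    using \<kappa> p by (intro eventually_conj) real_asymp+
  then obtain a0 where a0: "\<And>x. a0 \<le> x \<Longrightarrow> 1 \<le> x \<and> pi / 2 \<le> ln x \<and> p * pi / 2 \<le> ln x \<and> 2 \<le> \<kappa> * ln x powr p
          \<and> (2 * ln x) powr p \<le> x \<and> 2 * ln x \<le> x"
    by (auto simp: eventually_at_top_linorder)
  have a1: "1 \<le> a0" using a0[of a0] by simp
  let ?Z = "\<lambda>z::complex. z + of_real a0"
  let ?\<l> = "\<lambda>z. Ln (?Z z)"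
  let ?T = "\<lambda>z. of_real \<kappa> * ?\<l> z powr of_real p"
  have RZ: "a0 \<le> Re (?Z z)" "0 < Re (?Z z)" "a0 \<le> norm (?Z z)" "Re z + a0 \<le> norm (?Z z)" "?Z z \<noteq> 0"
    if "0 \<le> Re z" for z
  proof -
    show "a0 \<le> Re (?Z z)" "0 < Re (?Z z)" using that a1 by auto
    then show "a0 \<le> norm (?Z z)" "Re z + a0 \<le> norm (?Z z)" "?Z z \<noteq> 0"
      using complex_Re_le_cmod[of "?Z z"] by auto
  qed
  have Re_l: "Re (?\<l> z) = ln (norm (?Z z))" if "0 \<le> Re z" for z
    using RZ(5)[OF that] by simp
  note big = a0[OF RZ(3)]
  have Re_l_pos: "0 < Re (?\<l> z)" if "0 \<le> Re z" for z
    unfolding Re_l[OF that] using big[OF that] pi_gt_zero by linarith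
  have l_lower: "ln (norm (?Z z)) \<le> norm (?\<l> z)" if "0 \<le> Re z" for z
    using complex_Re_le_cmod[of "?\<l> z"] Re_l[OF that] by simp
  have l_upper: "norm (?\<l> z) \<le> 2 * ln (norm (?Z z))" if "0 \<le> Re z" for z
    using cmod_le[of "?\<l> z"] Re_l[OF that] Re_l_pos[OF that] abs_Im_Ln_less[OF RZ(2)[OF that]] big[OF that] by linarith
  have norm_T: "norm (?T z) = \<kappa> * norm (?\<l> z) powr p" if "0 \<le> Re z" for z
    using norm_powr_of_real[OF Re_l_pos[OF that]] \<kappa> by (simp add: norm_mult)
  have T_ge_2: "2 \<le> norm (?T z)" if "0 \<le> Re z" for z
  proof -
    have "\<kappa> * ln (norm (?Z z)) powr p \<le> \<kappa> * norm (?\<l> z) powr p"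
      using \<kappa> p l_lower[OF that] Re_l_pos[OF that] Re_l[OF that] by (intro mult_left_mono powr_mono2) auto
    then show ?thesis using big[OF that] norm_T[OF that] by linarith
  qed
  have angle: "\<bar>Im (Ln (?\<l> z))\<bar> \<le> (pi / 2) / ln (norm (?Z z))" if "0 \<le> Re z" for z
  proof -
    have "\<bar>Im (Ln (?\<l> z))\<bar> \<le> \<bar>Im (?\<l> z)\<bar> / ln (norm (?Z z))"
      using abs_Im_Ln_le[OF Re_l_pos[OF that]] Re_l[OF that] by simp
    also have "\<dots> \<le> (pi / 2) / ln (norm (?Z z))"
      using abs_Im_Ln_less[OF RZ(2)[OF that]] Re_l_pos[OF that] Re_l[OF that] by (intro divide_right_mono) auto
    finally show ?thesis .
  qed
  define c where "c = min 1 (p * pi)"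
  have c: "0 < c" "c \<le> 1" "c \<le> p * pi" using p by (auto simp: c_def)
  have far: "c \<le> norm (?T z - \<zeta>) * norm (?Z z)"
    if z: "0 \<le> Re z" and \<zeta>: "Re \<zeta> \<le> 0 \<or> b * norm \<zeta> powr (1 - q) \<le> Im \<zeta>" for z \<zeta>
  proof (rule ccontr)
    define X where "X = norm (?Z z)"
    define L where "L = norm (?\<l> z)"
    define t where "t = norm (?T z)"
    \<comment> \<open>the argument of $T(z)$\<close>
    define \<phi> where "\<phi> = p * Im (Ln (?\<l> z))"
    have X: "1 \<le> X" "L \<le> X" "0 < ln X" "p * pi / 2 \<le> ln X" "L \<le> 2 * ln X"
      using big[OF z] l_upper[OF z] Re_l_pos[OF z] Re_l[OF z] by (auto simp: X_def L_def)
    have "ln X \<le> L" using l_lower[OF z] by (simp only: L_def X_def)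
    then have L: "0 < L" using X(3) by linarith
    have t: "2 \<le> t" "t = \<kappa> * L powr p" using T_ge_2[OF z] norm_T[OF z] by (auto simp: t_def L_def)
    have tq: "t powr q = b' / (2 * p * pi) * L"
      using t(2) \<kappa> L q by (simp add: powr_mult powr_powr \<kappa>q)
    have ReT: "Re (?T z) = t * cos \<phi>" and ImT: "Im (?T z) = t * sin \<phi>"
      using Re_powr_of_real[OF Re_l_pos[OF z], of p] Im_powr_of_real[OF Re_l_pos[OF z], of p]
      by (simp_all add: t(2) \<phi>_def L_def)
    have "\<bar>\<phi>\<bar> = p * \<bar>Im (Ln (?\<l> z))\<bar>" using p by (simp add: \<phi>_def abs_mult)
    also have "\<dots> \<le> p * ((pi / 2) / ln X)"
      unfolding X_def using p by (intro mult_left_mono[OF angle[OF z]]) simp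
    also have "\<dots> = (p * pi / 2) / ln X" by simp
    finally have \<phi>: "\<bar>\<phi>\<bar> \<le> (p * pi / 2) / ln X" .
    have "(p * pi / 2) / ln X \<le> 1" using X by (simp add: divide_le_eq)
    then have "\<bar>\<phi>\<bar> \<le> pi / 3" using \<phi> pi_gt3 by linarith
    then have "cos (pi / 3) \<le> cos \<bar>\<phi>\<bar>" by (intro cos_monotone_0_pi_le) auto
    then have cos: "1 / 2 \<le> cos \<phi>" by (simp add: cos_60)
    have "(p * pi / 2) / ln X \<le> p * pi / L"
      using X L p by (simp add: field_simps)
    then have \<phi>L: "\<bar>\<phi>\<bar> \<le> p * pi / L" using \<phi> by linarith
    have "t powr (1 - q) = t / t powr q" using t(1) by (simp add: powr_diff)
    also have "\<dots> = t * (2 * p * pi) / (b' * L)" unfolding tq by simp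
    finally have tpow: "b' / 2 * t powr (1 - q) = t * (p * pi / L)" using b' L by (simp add: field_simps)
    have Im_small: "\<bar>Im (?T z)\<bar> \<le> b' / 2 * t powr (1 - q)"
    proof -
      have "\<bar>sin \<phi>\<bar> \<le> p * pi / L" using abs_sin_x_le_abs_x[of \<phi>] \<phi>L by linarith
      then have "t * \<bar>sin \<phi>\<bar> \<le> t * (p * pi / L)" using t(1) by (intro mult_left_mono) auto
      then show ?thesis unfolding tpow ImT using t(1) by (simp add: abs_mult)
    qed
    assume "\<not> ?thesis"
    then have less: "norm (?T z - \<zeta>) * X < c" by (simp add: X_def)
    have "norm (?T z - \<zeta>) * 1 \<le> norm (?T z - \<zeta>) * X" using X by (intro mult_left_mono) auto
    then have near: "norm (?T z - \<zeta>) < 1" using less c by linarith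
    have "1 \<le> t * cos \<phi>" using mult_mono[OF t(1) cos] t(1) by simp
    then have "\<not> Re \<zeta> \<le> 0"
      using near abs_Re_le_cmod[of "?T z - \<zeta>"] ReT by simp
    with \<zeta> have \<zeta>: "b * norm \<zeta> powr (1 - q) \<le> Im \<zeta>" by simp
    have "t / 2 \<le> norm \<zeta>" "norm \<zeta> \<le> 2 * t" "0 < t"
      using near t(1) norm_triangle_ineq2[of "?T z" \<zeta>] norm_triangle_ineq3[of "?T z" \<zeta>] by (auto simp: t_def)
    then have "2 powr (- \<bar>1 - q\<bar>) * t powr (1 - q) \<le> norm \<zeta> powr (1 - q)"
      by (intro powr_comparable)
    then have "b * (2 powr (- \<bar>1 - q\<bar>) * t powr (1 - q)) \<le> b * norm \<zeta> powr (1 - q)"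
      using b by (intro mult_left_mono) auto
    then have "b' * t powr (1 - q) \<le> Im \<zeta>" using \<zeta> by (simp add: b'_def)
    then have "b' / 2 * t powr (1 - q) \<le> \<bar>Im (?T z - \<zeta>)\<bar>" using Im_small by simp
    also have "\<dots> \<le> norm (?T z - \<zeta>)" by (rule abs_Im_le_cmod)
    finally have "t * (p * pi / L) \<le> norm (?T z - \<zeta>)" unfolding tpow .
    moreover have "p * pi / X \<le> t * (p * pi / L)"
    proof -
      have "p * pi / X \<le> 1 * (p * pi / L)" using X L p by (simp add: frac_le)
      also have "\<dots> \<le> t * (p * pi / L)" using t(1) p L by (intro mult_right_mono) auto
      finally show ?thesis .
    qed
    ultimately have "p * pi / X \<le> norm (?T z - \<zeta>)" by linarith
    then have "p * pi \<le> norm (?T z - \<zeta>) * X" using X by (simp add: divide_le_eq)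
    then show False using less c by linarith
  qed
  have "line_transform ?T (\<lambda>x. \<kappa> * ln (x + a0) powr p) (\<kappa> * (1 + a0)) (c / (1 + a0)) \<epsilon>
          {\<zeta>. Re \<zeta> \<le> 0 \<or> b * norm \<zeta> powr (1 - 1 / p) \<le> Im \<zeta>}"
  proof
    have "?Z z \<notin> \<real>\<^sub>\<le>\<^sub>0" "?\<l> z \<notin> \<real>\<^sub>\<le>\<^sub>0" if "0 \<le> Re z" for z
      using RZ(2)[OF that] Re_l_pos[OF that] by (auto simp: complex_nonpos_Reals_iff)
    then show "?T holomorphic_on half_plane" by (intro holomorphic_intros) auto
    show "filterlim (\<lambda>x. \<kappa> * ln (x + a0) powr p) at_top at_top" using \<kappa> p by real_asymp
    have "0 < \<kappa> * ln a0 powr p" using a0[of a0] by simp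
    then show "0 < \<kappa> * ln (0 + a0) powr p" by simp
    show "mono_on {0..} (\<lambda>x. \<kappa> * ln (x + a0) powr p)"
      using \<kappa> p a1 by (intro mono_onI mult_left_mono powr_mono2) auto
    fix z :: complex assume z: "0 \<le> Re z"
    show "norm (?T z) \<le> \<kappa> * (1 + a0) * (1 + norm z)"
    proof -
      have "norm (?\<l> z) powr p \<le> (2 * ln (norm (?Z z))) powr p"
        using l_upper[OF z] p by (intro powr_mono2) auto
      also have "\<dots> \<le> (1 + a0) * (1 + norm z)"
        using big[OF z] shift_norm_le[of a0 z] a1 by linarith
      finally have "\<kappa> * norm (?\<l> z) powr p \<le> \<kappa> * ((1 + a0) * (1 + norm z))"
        using \<kappa> by (intro mult_left_mono) auto
      then show ?thesis unfolding norm_T[OF z] by (simp only: mult.assoc)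
    qed
    show "\<kappa> * ln (Re z + a0) powr p \<le> norm (?T z)"
    proof -
      have "ln (Re z + a0) \<le> ln (norm (?Z z))"
        using RZ(4)[OF z] z a1 by (intro ln_mono) auto
      then have "ln (Re z + a0) \<le> norm (?\<l> z)" using l_lower[OF z] by linarith
      then show ?thesis unfolding norm_T[OF z] using \<kappa> p z a1 by (intro mult_left_mono powr_mono2) auto
    qed
    show "?T (cnj z) = cnj (?T z)"
    proof -
      have "?Z z \<notin> \<real>\<^sub>\<le>\<^sub>0" using RZ(2)[OF z] by (auto simp: complex_nonpos_Reals_iff)
      then have "Ln (?Z (cnj z)) = cnj (?\<l> z)" using cnj_Ln[of "?Z z"] by simp
      then show ?thesis using cnj_powr_of_real[OF Re_l_pos[OF z], of p] by simp
    qed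
    fix \<zeta> assume "\<zeta> \<in> {\<zeta>. Re \<zeta> \<le> 0 \<or> b * norm \<zeta> powr (1 - 1 / p) \<le> Im \<zeta>}"
    then have "c \<le> norm (?T z - \<zeta>) * norm (?Z z)" by (intro far[OF z]) (simp add: q_def)
    also have "\<dots> \<le> norm (?T z - \<zeta>) * ((1 + a0) * (1 + norm z))"
      using a1 by (intro mult_left_mono shift_norm_le) auto
    finally show "c / (1 + a0) \<le> norm (?T z - \<zeta>) * (1 + norm z)"
      using a1 by (simp add: divide_le_eq mult_ac)
  qed (use c a1 \<epsilon> in auto)
  then show ?thesis using \<kappa> a1 by blast
qed

text \<open>
  In the critical case $\xi > \eta$ the points $\zeta$ and $w$ satisfy $|x| \ge 1/(2|\zeta|)$, and
  $y \ge |x|^{1/\gamma}$ with $1/\gamma = 1 + q$ becomes the stated lower bound for $\eta = y|\zeta|^2$.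
\<close>

lemma cusp_region:
  assumes \<gamma>: "0 < \<gamma>" "\<gamma> < 1" and q: "q = (1 - \<gamma>) / \<gamma>"
    and w: "w \<in> approach_Delta (\<lambda>t. t powr \<gamma>)" "norm w < 1"
  shows "Re (- 1 / w) \<le> 0 \<or> 2 powr (- (1 + q)) * norm (- 1 / w) powr (1 - q) \<le> Im (- 1 / w)"
proof (cases "Re (- 1 / w) \<le> 0")
  case False
  from w(1) obtain x y where xy: "w = Complex x y" "\<bar>x\<bar> \<le> y powr \<gamma>" "0 < y" "y < 1" "0 < (norm w)\<^sup>2"
    "Re (- 1 / w) = - x / (norm w)\<^sup>2" "Im (- 1 / w) = y / (norm w)\<^sup>2" "y\<^sup>2 \<le> (norm w)\<^sup>2"
    by (rule approach_Delta_image)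
  define \<zeta> where "\<zeta> = - 1 / w"
  define N where "N = norm \<zeta>"
  have q0: "0 < q" "1 + q = 1 / \<gamma>" using \<gamma> by (auto simp: q field_simps)
  have N: "1 < N" "(norm w)\<^sup>2 = 1 / N\<^sup>2"
    using w(2) xy(5) by (auto simp: N_def \<zeta>_def norm_divide power_divide)
  have Re: "Re \<zeta> = - x * N\<^sup>2" and Im: "Im \<zeta> = y * N\<^sup>2"
    using xy(6,7) N by (simp_all add: \<zeta>_def)
  have pos: "0 < Re \<zeta>" "0 < Im \<zeta>" using False Im xy(3) N by (auto simp: \<zeta>_def)
  have split: "N \<le> Re \<zeta> + Im \<zeta>" using cmod_le[of \<zeta>] pos by (simp add: N_def)
  have b: "2 powr (- (1 + q)) \<le> 1 / 2"
    using powr_mono[of "- (1 + q)" "- 1" 2] q0 by (simp add: powr_minus_divide)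
  have "2 powr (- (1 + q)) * N powr (1 - q) \<le> Im \<zeta>"
  proof (cases "Re \<zeta> \<le> Im \<zeta>")
    case True
    have "N powr (1 - q) \<le> N powr 1" using N q0 by (intro powr_mono) auto
    then have "2 powr (- (1 + q)) * N powr (1 - q) \<le> 1 / 2 * N" using b N by (intro mult_mono) auto
    then show ?thesis using True split by linarith
  next
    case False
    have "N \<le> 2 * (- x * N\<^sup>2)" using False split Re by linarith
    also have "- x * N\<^sup>2 \<le> \<bar>x\<bar> * N\<^sup>2" by (intro mult_right_mono) auto
    finally have "N * 1 \<le> N * (\<bar>x\<bar> * (2 * N))" by (simp add: power2_eq_square mult_ac)
    then have "1 \<le> \<bar>x\<bar> * (2 * N)" using N(1) by (subst (asm) mult_le_cancel_left_pos) auto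
    then have "1 / (2 * N) \<le> \<bar>x\<bar>" using N(1) by (simp add: divide_le_eq)
    also have "\<bar>x\<bar> \<le> y powr \<gamma>" by (rule xy(2))
    finally have "(1 / (2 * N)) powr (1 + q) \<le> (y powr \<gamma>) powr (1 + q)"
      using N(1) q0(1) by (intro powr_mono2) auto
    also have "\<dots> = y" using q0 \<gamma> xy(3) by (simp add: powr_powr)
    also have "(1 / (2 * N)) powr (1 + q) = 2 powr (- (1 + q)) * N powr (- (1 + q))"
      unfolding powr_minus_divide using N(1) by (simp add: powr_divide powr_mult)
    finally have "2 powr (- (1 + q)) * N powr (- (1 + q)) * N\<^sup>2 \<le> Im \<zeta>"
      unfolding Im by (rule mult_right_mono) simp
    moreover have "N powr (- (1 + q)) * N\<^sup>2 = N powr (1 - q)"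
      using powr_add[of N "- (1 + q)" 2] N(1) by simp
    ultimately show ?thesis by (simp only: mult.assoc)
  qed
  then show ?thesis unfolding \<zeta>_def N_def by (rule disjI2)
qed simp

lemma log_plus_log_plus_le:
  assumes "s \<le> exp (exp t)" "0 \<le> t"
  shows "log_plus (log_plus s) \<le> t"
  by (intro log_plus_le[OF log_plus_le]) (use assms in auto)

text \<open>
  The growth in $|\zeta|$ alone, combined with $|\zeta| \le 2/(1-r)$, would give too large an exponent. But
  inside the approach region the function is bounded, and outside it $|w| \ge |x| > y^\gamma$, that is
  $|\zeta| < y^{-\gamma}$, where $y \ge (1-r)/4$.
\<close>

lemma cusp_case:
  fixes \<gamma> :: real
  assumes \<gamma>: "0 < \<gamma>" "\<gamma> < 1"
  shows "\<exists>k u. harmonic_on unit_disc u \<and> (\<exists>z\<in>unit_disc. u z \<noteq> 0) \<and>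
    vanishing_approach_limits (\<lambda>t. t powr \<gamma>) u \<and>
    (\<forall>r. 0 < r \<and> r < 1 \<longrightarrow> log_plus (log_plus (circle_max r (\<lambda>z. \<bar>u z\<bar>))) \<le> k * (1 - r) powr (\<gamma> - 1))"
proof -
  define q where "q = (1 - \<gamma>) / \<gamma>"
  define p where "p = \<gamma> / (1 - \<gamma>)"
  have pq: "0 < p" "0 < q" "1 / p = q" "q * p = 1" "\<gamma> * q = 1 - \<gamma>" using \<gamma> by (auto simp: p_def q_def)
  define D where "D = {\<zeta>. Re \<zeta> \<le> 0 \<or> 2 powr (- (1 + q)) * norm \<zeta> powr (1 - q) \<le> Im \<zeta>}"
  obtain \<kappa> a0 C c where \<kappa>: "0 < \<kappa>" and a0: "1 \<le> a0" and
    lt: "line_transform (\<lambda>z. of_real \<kappa> * Ln (z + of_real a0) powr of_real p) (\<lambda>x. \<kappa> * ln (x + a0) powr p)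
      C c (1 / 6) D"
    using cusp_line_transform[OF pq(1), of "2 powr (- (1 + q))" "1 / 6"] unfolding D_def pq(3) by auto
  have region: "- 1 / w \<in> D" if "w \<in> approach_Delta (\<lambda>t. t powr \<gamma>)" "norm w < 1" for w
    using cusp_region[OF \<gamma> q_def that] by (simp only: D_def mem_Collect_eq)
  from line_transform.exists_harmonic[OF lt, of "\<lambda>t. t powr \<gamma>", OF region]
  obtain u where u: "harmonic_on unit_disc u" "\<exists>z\<in>unit_disc. u z \<noteq> 0"
      "vanishing_approach_limits (\<lambda>t. t powr \<gamma>) u"
    and "\<forall>z\<in>unit_disc. \<forall>a\<ge>0. 2 * norm (cayley z) \<le> \<kappa> * ln (a + a0) powr p \<longrightarrow> \<bar>u z\<bar> \<le> exp (6 * (1 / 6) * a)"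
    and bounded: "\<forall>z\<in>unit_disc. cayley z \<in> D \<longrightarrow> 1 \<le> norm (cayley z) \<longrightarrow> \<bar>u z\<bar> \<le> 1"
    by auto
  then have growth: "\<And>z a. z \<in> unit_disc \<Longrightarrow> 0 \<le> a \<Longrightarrow> 2 * norm (cayley z) \<le> \<kappa> * ln (a + a0) powr p \<Longrightarrow> \<bar>u z\<bar> \<le> exp a"
    by auto
  have double_exp: "\<bar>u z\<bar> \<le> exp (exp ((2 / \<kappa>) powr q * norm (cayley z) powr q))" if z: "z \<in> unit_disc" for z
  proof (rule growth[OF z])
    let ?s = "(2 / \<kappa>) powr q * norm (cayley z) powr q"
    have s: "?s = (2 * norm (cayley z) / \<kappa>) powr q" using \<kappa> by (simp flip: powr_mult)
    have "2 * norm (cayley z) = \<kappa> * ?s powr p"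
      unfolding s using \<kappa> pq by (simp add: powr_powr)
    also have "\<dots> \<le> \<kappa> * ln (exp ?s + a0) powr p"
    proof -
      have "?s = ln (exp ?s)" by simp
      also have "\<dots> \<le> ln (exp ?s + a0)" using a0 by (subst ln_le_cancel_iff) (auto intro: add_pos_nonneg)
      finally show ?thesis using \<kappa> pq by (intro mult_left_mono powr_mono2) auto
    qed
    finally show "2 * norm (cayley z) \<le> \<kappa> * ln (exp ?s + a0) powr p" .
  qed simp
  define k where "k = (2 / \<kappa>) powr q * 4 powr (1 - \<gamma>)"
  have k: "0 \<le> k" by (simp add: k_def)
  have "log_plus (log_plus (circle_max r (\<lambda>z. \<bar>u z\<bar>))) \<le> k * (1 - r) powr (\<gamma> - 1)" if r: "0 < r" "r < 1" for r
  proof (rule log_plus_log_plus_le[OF circle_max_le])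
    fix z :: complex assume z: "norm z = r"
    then have zd: "z \<in> unit_disc" using r by simp
    define K where "K = (1 - r) powr (\<gamma> - 1)"
    have K: "0 \<le> K" by (simp add: K_def)
    show "\<bar>u z\<bar> \<le> exp (exp (k * K))"
    proof (cases "norm (cayley z) powr q \<le> 4 powr (1 - \<gamma>) * K")
      case True
      then have "(2 / \<kappa>) powr q * norm (cayley z) powr q \<le> k * K"
        unfolding k_def mult.assoc by (intro mult_left_mono) auto
      then have "exp (exp ((2 / \<kappa>) powr q * norm (cayley z) powr q)) \<le> exp (exp (k * K))" by simp
      with double_exp[OF zd] show ?thesis by linarith
    next
      case False
      \<comment> \<open>the point of the half-plane with $z = f_0(w)$, for which $-1/w$ is \<open>cayley z\<close>\<close>
      define w where "w = cayley (- z)"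
      have ne: "1 - z \<noteq> 0" "1 + z \<noteq> 0"
        using z r norm_minus_cancel[of "1::complex"] by (auto simp: add_eq_0_iff)
      have w: "- 1 / w = cayley z" "cayley z = - 1 / w"
        using ne by (simp_all add: w_def cayley_def field_simps)
      define y where "y = (1 - r) / 4"
      have y: "0 < y" "y \<le> 1" using r by (auto simp: y_def)
      have Kpow: "4 powr (1 - \<gamma>) * K = y powr (- (1 - \<gamma>))"
        using r powr_minus_divide[of 4 "1 - \<gamma>"] by (simp add: K_def y_def powr_divide)
      have Im_w: "y \<le> Im w"
      proof -
        have "- z \<noteq> 1"
        proof
          assume "- z = 1"
          then have "z = - 1" by (metis minus_minus)
          with ne(2) show False by simp
        qed
        then have Im: "Im w = (1 - r\<^sup>2) / (norm (1 + z))\<^sup>2" using Im_cayley[of "- z"] z by (simp add: w_def)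
        have "(1 - r) * 1 \<le> (1 - r) * (1 + r)" using r by (intro mult_left_mono) auto
        then have "1 - r \<le> 1 - r\<^sup>2" by (simp add: power2_eq_square algebra_simps)
        moreover have "(norm (1 + z))\<^sup>2 \<le> 2\<^sup>2"
          using norm_triangle_ineq[of 1 z] z r by (intro power_mono) auto
        moreover have "0 < (norm (1 + z))\<^sup>2" using ne by simp
        ultimately have "(1 - r) / 2\<^sup>2 \<le> (1 - r\<^sup>2) / (norm (1 + z))\<^sup>2" using r by (intro frac_le) auto
        then show ?thesis by (simp add: y_def Im)
      qed
      have norm_w: "norm (cayley z) = 1 / norm w" unfolding w(2) by (simp add: norm_divide)
      have w0: "0 < norm w" using Im_w y by auto
      have big: "y powr (- \<gamma>) < norm (cayley z)"
      proof (rule ccontr)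
        assume "\<not> ?thesis"
        then have "norm (cayley z) powr q \<le> (y powr (- \<gamma>)) powr q" using pq by (intro powr_mono2) auto
        also have "\<dots> = y powr (- (1 - \<gamma>))" using pq(5) by (simp add: powr_powr)
        finally show False using False Kpow by simp
      qed
      have one: "1 \<le> y powr (- \<gamma>)" using y \<gamma> powr_mono2'[of "- \<gamma>" y 1] by simp
      then have "1 < norm (cayley z)" using big by linarith
      then have norm1: "norm w < 1" "1 \<le> norm (cayley z)" using norm_w w0 by auto
      have "norm w \<le> y powr \<gamma>"
        using big w0 y unfolding norm_w by (simp add: powr_minus_divide field_simps)
      then have "\<bar>Re w\<bar> \<le> Im w powr \<gamma>"
        using abs_Re_le_cmod[of w] powr_mono2[of \<gamma> y "Im w"] Im_w y \<gamma> by linarith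
      moreover have "0 < Im w" "Im w < 1" using Im_w y norm1 abs_Im_le_cmod[of w] by auto
      ultimately have "w \<in> approach_Delta (\<lambda>t. t powr \<gamma>)"
        unfolding approach_Delta_def mem_Collect_eq by (metis complex_surj)
      from region[OF this norm1(1)] have "cayley z \<in> D" unfolding w(1) .
      then have "\<bar>u z\<bar> \<le> 1" using bounded zd norm1(2) by blast
      also have "1 \<le> exp (exp (k * K))" by simp
      finally show ?thesis .
    qed
  qed (use r k in auto)
  then show ?thesis using u by blast
qed

theorem proposition1p4:
  shows
    "(\<forall>h :: real \<Rightarrow> real. approach_function h \<and> h \<in> o[at_right 0](\<lambda>t. t ^ 3) \<longrightarrow>
        (\<exists>u :: complex \<Rightarrow> real. harmonic_on unit_disc u \<and> (\<exists>z\<in>unit_disc. u z \<noteq> 0) \<and>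
           vanishing_approach_limits h u \<and>
           (\<lambda>r. circle_max r (\<lambda>z. \<bar>u z\<bar>)) \<in> O[at_left 1](\<lambda>r. 1 / (1 - r) ^ 2)))
   \<and> (\<forall>\<gamma> \<epsilon> :: real. 1 < \<gamma> \<and> \<gamma> \<le> 3 \<and> 0 < \<epsilon> \<longrightarrow>
        (\<exists>u :: complex \<Rightarrow> real. harmonic_on unit_disc u \<and> (\<exists>z\<in>unit_disc. u z \<noteq> 0) \<and>
           vanishing_approach_limits (\<lambda>t. t powr \<gamma>) u \<and>
           (\<forall>r. 0 < r \<and> r < 1 \<longrightarrow>
              log_plus (circle_max r (\<lambda>z. \<bar>u z\<bar>)) \<le> \<epsilon> * (1 / (1 - r)))))
   \<and> (\<forall>c \<epsilon> :: real. 0 < c \<and> 0 < \<epsilon> \<longrightarrow>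
        (\<exists>u :: complex \<Rightarrow> real. harmonic_on unit_disc u \<and> (\<exists>z\<in>unit_disc. u z \<noteq> 0) \<and>
           vanishing_approach_limits (\<lambda>t. c * t) u \<and>
           (\<forall>r. 0 < r \<and> r < 1 \<longrightarrow>
              log_plus (circle_max r (\<lambda>z. \<bar>u z\<bar>))
                \<le> \<epsilon> * (1 - r) powr (- (pi / (2 * arctan (1 / c)))))))
   \<and> (\<forall>\<gamma> :: real. 0 < \<gamma> \<and> \<gamma> < 1 \<longrightarrow>
        (\<exists>k :: real. \<exists>u :: complex \<Rightarrow> real.
           harmonic_on unit_disc u \<and> (\<exists>z\<in>unit_disc. u z \<noteq> 0) \<and>
           vanishing_approach_limits (\<lambda>t. t powr \<gamma>) u \<and>
           (\<forall>r. 0 < r \<and> r < 1 \<longrightarrow>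
              log_plus (log_plus (circle_max r (\<lambda>z. \<bar>u z\<bar>))) \<le> k * (1 - r) powr (\<gamma> - 1))))"
proof (intro conjI allI impI)
  fix h :: "real \<Rightarrow> real"
  assume "approach_function h \<and> h \<in> o[at_right 0](\<lambda>t. t ^ 3)"
  then show "\<exists>u. harmonic_on unit_disc u \<and> (\<exists>z\<in>unit_disc. u z \<noteq> 0) \<and> vanishing_approach_limits h u \<and>
      (\<lambda>r. circle_max r (\<lambda>z. \<bar>u z\<bar>)) \<in> O[at_left 1](\<lambda>r. 1 / (1 - r) ^ 2)"
    by (intro cubic_tangency) simp
next
  fix \<gamma> \<epsilon> :: real
  assume "1 < \<gamma> \<and> \<gamma> \<le> 3 \<and> 0 < \<epsilon>"
  then show "\<exists>u. harmonic_on unit_disc u \<and> (\<exists>z\<in>unit_disc. u z \<noteq> 0) \<and>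
      vanishing_approach_limits (\<lambda>t. t powr \<gamma>) u \<and>
      (\<forall>r. 0 < r \<and> r < 1 \<longrightarrow> log_plus (circle_max r (\<lambda>z. \<bar>u z\<bar>)) \<le> \<epsilon> * (1 / (1 - r)))"
    by (intro tangential_case) auto
next
  fix c \<epsilon> :: real
  assume "0 < c \<and> 0 < \<epsilon>"
  then show "\<exists>u. harmonic_on unit_disc u \<and> (\<exists>z\<in>unit_disc. u z \<noteq> 0) \<and>
      vanishing_approach_limits (\<lambda>t. c * t) u \<and>
      (\<forall>r. 0 < r \<and> r < 1 \<longrightarrow> log_plus (circle_max r (\<lambda>z. \<bar>u z\<bar>))
        \<le> \<epsilon> * (1 - r) powr (- (pi / (2 * arctan (1 / c)))))"
    by (intro sector_case) auto
next
  fix \<gamma> :: real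
  assume "0 < \<gamma> \<and> \<gamma> < 1"
  then show "\<exists>k u. harmonic_on unit_disc u \<and> (\<exists>z\<in>unit_disc. u z \<noteq> 0) \<and>
      vanishing_approach_limits (\<lambda>t. t powr \<gamma>) u \<and>
      (\<forall>r. 0 < r \<and> r < 1 \<longrightarrow>
        log_plus (log_plus (circle_max r (\<lambda>z. \<bar>u z\<bar>))) \<le> k * (1 - r) powr (\<gamma> - 1))"
    by (intro cusp_case) auto
qed

end
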